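(* Let $\eta$ be a rational 1-form on $\widehat{\mathbb{C}}$ with simple poles and simple zeros and with finite non-trivial isotropy group $G$. Let $E\subset\widehat{\mathbb{C}}$ be a circle such that the reflection $\rho_E$ along $E$ satisfies, for all $p\in\mathcal{P}_\eta$ and all $q\in\mathcal{Z}_\eta$, 1) $\rho_E(p)\in\mathcal{O}(p)\subset\mathcal{P}_\eta$, 2) $\rho_E(q)\in\mathcal{O}(q)\subset\mathcal{Z}_\eta$. Then there exists $\theta\in\mathbb{R}$ such that $e^{i\theta}\eta$ is isochronous.
   Context: $\mathcal{P}_\eta,\mathcal{Z}_\eta$ are the sets of poles and zeros of $\eta$ in $\widehat{\mathbb{C}}$; the isotropy group of $\eta$ is $\{T\in PSL(2,\mathbb{C}):T_*\eta=\eta\}$ with $T_*\eta=(T^{-1})^*\eta$. $\mathcal{O}(p)$ is the $G$-orbit of $p$. A circle in $\widehat{\mathbb{C}}$ passing through $\infty$ is a line in $\mathbb{C}$; $\rho_E$ is the anti-holomorphic reflection (inversion) of $\widehat{\mathbb{C}}$ fixing $E$ pointwise. A 1-form $\eta=dz/f$ is isochronous if all zeros of the associated vector field $f\,\partial/\partial z$ are centers (each zero is surrounded by a neighborhood filled by closed orbits); for a 1-form with simple poles this is equivalent to all residues of $\eta$ being purely imaginary. *)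

theory Defs
  imports "HOL-Complex_Analysis.Complex_Analysis"
begin

text \<open>
  The Riemann sphere is the one-point compactification of the complex plane: \<open>None\<close> is the point
  at infinity.
\<close>

type_synonym riemann_sphere = "complex option"

definition sphere_topology :: "riemann_sphere topology" where
  "sphere_topology = Alexandroff_compactification (euclidean :: complex topology)"

text \<open>
  The value of \<open>sphere_coord p\<close> at points outside its chart domain (\<open>None\<close> if \<open>p\<close> is finite,
  \<open>Some 0\<close> if \<open>p = None\<close>) is a dummy.
\<close>

fun sphere_coord :: "riemann_sphere \<Rightarrow> riemann_sphere \<Rightarrow> complex" where
  "sphere_coord (Some a) (Some z) = z - a"
| "sphere_coord (Some a) None = 0"
| "sphere_coord None (Some z) = 1 / z"
| "sphere_coord None None = 0"


section \<open>Moebius transformations\<close>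

fun moebius_map :: "complex \<Rightarrow> complex \<Rightarrow> complex \<Rightarrow> complex \<Rightarrow> riemann_sphere \<Rightarrow> riemann_sphere" where
  "moebius_map a b c d (Some z) = (if c * z + d = 0 then None else Some ((a * z + b) / (c * z + d)))"
| "moebius_map a b c d None = (if c = 0 then None else Some (a / c))"

text \<open>\<open>PSL(2,\<complex>)\<close> is identified with its faithful action on the sphere.\<close>

definition PSL2C :: "(riemann_sphere \<Rightarrow> riemann_sphere) set" where
  "PSL2C = {moebius_map a b c d | a b c d. a * d - b * c = 1}"


section \<open>Rational 1-forms\<close>

text \<open>
  A rational 1-form \<open>\<eta> = h(z) dz\<close> on the sphere is represented by its coefficient function \<open>h\<close>.
  Its values at its finitely many singularities are irrelevant: orders, isotropy and trajectories only
  depend on \<open>h\<close> up to a sparse set.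
\<close>

definition rational_form :: "(complex \<Rightarrow> complex) \<Rightarrow> bool" where
  "rational_form h \<longleftrightarrow> (\<exists>P Q :: complex poly. Q \<noteq> 0 \<and> (\<forall>z. h z = poly P z / poly Q z))"

text \<open>
  The coefficient of \<open>\<eta>\<close> in the chart \<open>sphere_coord p\<close>; at infinity \<open>z = 1 / w\<close> gives
  \<open>dz = - dw / w\<^sup>2\<close>.
\<close>

fun local_coeff :: "(complex \<Rightarrow> complex) \<Rightarrow> riemann_sphere \<Rightarrow> complex \<Rightarrow> complex" where
  "local_coeff h (Some a) w = h (a + w)"
| "local_coeff h None w = - h (1 / w) / w\<^sup>2"

definition form_order :: "(complex \<Rightarrow> complex) \<Rightarrow> riemann_sphere \<Rightarrow> int" where
  "form_order h p = zorder (local_coeff h p) 0"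

definition form_poles :: "(complex \<Rightarrow> complex) \<Rightarrow> riemann_sphere set" where
  "form_poles h = {p. form_order h p < 0}"

definition form_zeros :: "(complex \<Rightarrow> complex) \<Rightarrow> riemann_sphere set" where
  "form_zeros h = {p. form_order h p > 0}"

definition simple_poles :: "(complex \<Rightarrow> complex) \<Rightarrow> bool" where
  "simple_poles h \<longleftrightarrow> (\<forall>p\<in>form_poles h. form_order h p = -1)"

definition simple_zeros :: "(complex \<Rightarrow> complex) \<Rightarrow> bool" where
  "simple_zeros h \<longleftrightarrow> (\<forall>p\<in>form_zeros h. form_order h p = 1)"

text \<open>
  \<open>T\<^sup>*\<eta> = h(T z) T'(z) dz\<close>. At a finite \<open>z\<close> with \<open>T z = \<infinity>\<close> the right-hand side is a dummy value, which
  is harmless because forms are only compared off a sparse set.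
\<close>

definition pullback ::
  "(riemann_sphere \<Rightarrow> riemann_sphere) \<Rightarrow> (complex \<Rightarrow> complex) \<Rightarrow> complex \<Rightarrow> complex" where
  "pullback T h = (\<lambda>z. h (the (T (Some z))) * deriv (\<lambda>u. the (T (Some u))) z)"

definition pushforward ::
  "(riemann_sphere \<Rightarrow> riemann_sphere) \<Rightarrow> (complex \<Rightarrow> complex) \<Rightarrow> complex \<Rightarrow> complex" where
  "pushforward T h = pullback (inv T) h"

definition form_eq :: "(complex \<Rightarrow> complex) \<Rightarrow> (complex \<Rightarrow> complex) \<Rightarrow> bool" where
  "form_eq h k \<longleftrightarrow> (\<forall>\<^sub>\<approx>z\<in>UNIV. h z = k z)"

definition isotropy_group :: "(complex \<Rightarrow> complex) \<Rightarrow> (riemann_sphere \<Rightarrow> riemann_sphere) set" where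
  "isotropy_group h = {T \<in> PSL2C. form_eq (pushforward T h) h}"

definition orbit_of ::
  "(riemann_sphere \<Rightarrow> riemann_sphere) set \<Rightarrow> riemann_sphere \<Rightarrow> riemann_sphere set" where
  "orbit_of G p = {T p | T. T \<in> G}"


section \<open>Circles and reflections\<close>

definition is_circle :: "riemann_sphere set \<Rightarrow> bool" where
  "is_circle E \<longleftrightarrow>
     (\<exists>c r. r > 0 \<and> E = Some ` sphere c r) \<or>
     (\<exists>a u. u \<noteq> 0 \<and> E = insert None (Some ` range (\<lambda>t. a + of_real t * u)))"

text \<open>
  The anti-holomorphic automorphisms of the sphere are the maps \<open>T \<circ> conjugation\<close> with
  \<open>T \<in> PSL(2,\<complex>)\<close>; exactly one of them fixes a given circle pointwise.
\<close>

definition antiholomorphic_automorphisms :: "(riemann_sphere \<Rightarrow> riemann_sphere) set" where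
  "antiholomorphic_automorphisms = {T \<circ> map_option cnj | T. T \<in> PSL2C}"

definition circle_reflection :: "riemann_sphere set \<Rightarrow> riemann_sphere \<Rightarrow> riemann_sphere" where
  "circle_reflection E = (THE \<rho>. \<rho> \<in> antiholomorphic_automorphisms \<and> (\<forall>p\<in>E. \<rho> p = p))"


text \<open>Existence and uniqueness of the reflection, in the form of the usual inversion formulas.\<close>

lemma moebius_map_scale: assumes "k \<noteq> 0" shows "moebius_map (k*a) (k*b) (k*c) (k*d) = moebius_map a b c d"
proof
  fix p show "moebius_map (k*a) (k*b) (k*c) (k*d) p = moebius_map a b c d p"
  proof (cases p)
    case None then show ?thesis using assms by simp
  next
    case (Some z)
    have "k*c*z+k*d = k*(c*z+d)" "k*a*z+k*b = k*(a*z+b)" by (auto simp: algebra_simps)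
    then show ?thesis using assms Some by simp
  qed
qed

lemma moebius_map_in_PSL2C: assumes "a*d-b*c \<noteq> 0" shows "moebius_map a b c d \<in> PSL2C"
proof -
  define k where "k = 1 / csqrt (a*d-b*c)"
  have k: "k \<noteq> 0" "k^2 * (a*d-b*c) = 1" using assms by (auto simp: k_def power_divide)
  have "(k*a)*(k*d)-(k*b)*(k*c) = 1" using k(2) by (simp add: algebra_simps power2_eq_square)
  then have "moebius_map (k*a) (k*b) (k*c) (k*d) \<in> PSL2C" unfolding PSL2C_def by blast
  then show ?thesis using moebius_map_scale[OF k(1), of a b c d] by simp
qed

lemma quadratic_three_roots: fixes A B C x y z :: complex
  assumes "A*x^2+B*x+C=0" "A*y^2+B*y+C=0" "A*z^2+B*z+C=0" "x\<noteq>y" "y\<noteq>z" "x\<noteq>z"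
  shows "A=0 \<and> B=0 \<and> C=0"
proof -
  have 1: "(x-y)*(A*(x+y)+B) = 0" using assms(1,2) by algebra
  have 2: "(x-z)*(A*(x+z)+B) = 0" using assms(1,3) by algebra
  have "A*(y-z) = 0" using 1 2 assms(4,6) by (metis (no_types, opaque_lifting) add_diff_cancel_left add_diff_cancel_right eq_iff_diff_eq_0 mult_eq_0_iff right_diff_distrib')
  then have A: "A=0" using assms by simp
  then show ?thesis using 1 assms by auto
qed

lemma moebius_map_unique:
  assumes "a*d-b*c=1" "a'*d'-b'*c'=1" "x\<noteq>y" "y\<noteq>z" "x\<noteq>z"
    and e: "\<And>u. u\<in>{x,y,z} \<Longrightarrow> \<exists>v. moebius_map a b c d (Some u) = Some v \<and> moebius_map a' b' c' d' (Some u) = Some v"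
  shows "moebius_map a b c d = moebius_map a' b' c' d'"
proof -
  have *: "(a*u+b)*(c'*u+d') = (a'*u+b')*(c*u+d)" if "u\<in>{x,y,z}" for u
  proof -
    have n: "c*u+d \<noteq> 0" "c'*u+d' \<noteq> 0" "(a*u+b)/(c*u+d) = (a'*u+b')/(c'*u+d')"
      using e[OF that] by (auto split: if_splits)
    then show ?thesis by (simp add: frac_eq_eq)
  qed
  have "(a*c'-a'*c)*u^2+(a*d'+b*c'-a'*d-b'*c)*u+(b*d'-b'*d)=0" if "u\<in>{x,y,z}" for u
    using *[OF that] by algebra
  then have r: "a*c'-a'*c=0 \<and> a*d'+b*c'-a'*d-b'*c = 0 \<and> b*d'-b'*d=0"
    using assms(3-5) by (intro quadratic_three_roots[of _ x _ _ y z]) auto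
  have **: "(a*u+b)*(c'*u+d') = (a'*u+b')*(c*u+d)" for u using r by algebra
  show ?thesis
  proof
    fix p show "moebius_map a b c d p = moebius_map a' b' c' d' p"
    proof (cases p)
      case None
      have "c = 0 \<longleftrightarrow> c' = 0" using r assms(1,2) by auto
      then show ?thesis using None r by (auto simp: field_simps)
    next
      case (Some u)
      have n: "\<not>(a*u+b=0 \<and> c*u+d=0)" using assms(1) by algebra
      have n': "\<not>(a'*u+b'=0 \<and> c'*u+d'=0)" using assms(2) by algebra
      have "c*u+d=0 \<longleftrightarrow> c'*u+d'=0" using n n' **[of u] by auto
      then show ?thesis using Some **[of u] by (auto simp: frac_eq_eq)
    qed
  qed
qed

lemma circle_reflection_eqI:
  assumes "a*d-b*c \<noteq> 0" and r: "\<rho> = moebius_map a b c d \<circ> map_option cnj"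
    and f: "\<And>p. p\<in>E \<Longrightarrow> \<rho> p = p"
    and "x\<noteq>y" "y\<noteq>z" "x\<noteq>z" "Some x \<in> E" "Some y \<in> E" "Some z \<in> E"
  shows "circle_reflection E = \<rho>"
  unfolding circle_reflection_def
proof (rule the_equality)
  show "\<rho> \<in> antiholomorphic_automorphisms \<and> (\<forall>p\<in>E. \<rho> p = p)"
    using moebius_map_in_PSL2C[OF assms(1)] r f by (auto simp: antiholomorphic_automorphisms_def)
next
  fix \<sigma> assume s: "\<sigma> \<in> antiholomorphic_automorphisms \<and> (\<forall>p\<in>E. \<sigma> p = p)"
  then obtain a' b' c' d' where 1: "a'*d'-b'*c'=1" "\<sigma> = moebius_map a' b' c' d' \<circ> map_option cnj"
    by (auto simp: antiholomorphic_automorphisms_def PSL2C_def)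
  obtain a2 b2 c2 d2 where 2: "a2*d2-b2*c2=1" "moebius_map a b c d = moebius_map a2 b2 c2 d2"
    using moebius_map_in_PSL2C[OF assms(1)] by (auto simp: PSL2C_def)
  have "moebius_map a' b' c' d' = moebius_map a2 b2 c2 d2"
  proof (rule moebius_map_unique[OF 1(1) 2(1), of "cnj x" "cnj y" "cnj z"])
    fix u assume "u \<in> {cnj x, cnj y, cnj z}"
    then have uE: "Some (cnj u) \<in> E" using assms by auto
    have "\<sigma> (Some (cnj u)) = Some (cnj u)" "\<rho> (Some (cnj u)) = Some (cnj u)" using s f uE by auto
    then show "\<exists>v. moebius_map a' b' c' d' (Some u) = Some v \<and> moebius_map a2 b2 c2 d2 (Some u) = Some v"
      unfolding 1(2) r by (metis 2(2) comp_apply complex_cnj_cnj option.simps(9))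
  qed (use assms in auto)
  then show "\<sigma> = \<rho>" using 1 2 r by simp
qed

lemma circle_reflection_circle:
  assumes r: "(r::real) > 0" and E_def: "E = Some ` sphere c r"
  shows "circle_reflection E None = Some c"
    and "circle_reflection E (Some z) = (if z = c then None else Some (c + of_real (r^2) / cnj (z - c)))"
proof -
  have E: "circle_reflection E = moebius_map c (of_real (r^2) - c * cnj c) 1 (- cnj c) \<circ> map_option cnj"
  proof (rule circle_reflection_eqI[OF _ refl, of _ _ _ _ _ "c + of_real r" "c - of_real r" "c + \<i> * of_real r"])
    fix p assume "p\<in>E"
    then obtain z where z: "p = Some z" "norm (z - c) = r" by (auto simp: E_def dist_norm norm_minus_commute)
    then have "(z-c)*cnj (z-c) = of_real (r^2)" by (metis complex_norm_square)
    moreover have "z \<noteq> c" using z r by auto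
    ultimately show "(moebius_map c (of_real (r^2) - c * cnj c) 1 (- cnj c) \<circ> map_option cnj) p = p"
      using z(1) by (auto simp: field_simps)
  qed (use r in \<open>auto simp: E_def dist_norm norm_mult complex_eq_iff\<close>)
  show "circle_reflection E None = Some c" by (simp add: E)
  show "circle_reflection E (Some z) = (if z = c then None else Some (c + of_real (r^2) / cnj (z - c)))"
    by (auto simp: E field_simps)
qed

lemma circle_reflection_line:
  assumes u: "u \<noteq> 0" and E_def: "E = insert None (Some ` range (\<lambda>t::real. a + of_real t * u))"
  shows "circle_reflection E None = None"
    and "circle_reflection E (Some z) = Some (a + u * cnj ((z - a) / u))"
proof -
  have E: "circle_reflection E = moebius_map (u / cnj u) (a - u * cnj a / cnj u) 0 1 \<circ> map_option cnj"
  proof (rule circle_reflection_eqI[OF _ refl, of _ _ _ _ _ a "a+u" "a+2*u"])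
    fix p assume "p\<in>E"
    then show "(moebius_map (u / cnj u) (a - u * cnj a / cnj u) 0 1 \<circ> map_option cnj) p = p"
      using u by (auto simp: E_def field_simps)
  next
    show "Some a \<in> E" "Some (a+u) \<in> E" "Some (a+2*u) \<in> E"
      unfolding E_def by (auto simp: image_iff intro: exI[of _ "0::real"] exI[of _ "1::real"] exI[of _ "2::real"])
  qed (use u in auto)
  show "circle_reflection E None = None" by (simp add: E)
  show "circle_reflection E (Some z) = Some (a + u * cnj ((z - a) / u))"
    using u by (auto simp: E field_simps)
qed


section \<open>The associated vector field, centers, isochronous forms\<close>

text \<open>
  For \<open>\<eta> = dz / f\<close> this is the component of \<open>f \<partial>/\<partial>z\<close> in the chart \<open>sphere_coord p\<close>. It is
  meromorphic; \<open>remove_sings\<close> supplies its value at a removable singularity.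
\<close>

definition field_coeff :: "(complex \<Rightarrow> complex) \<Rightarrow> riemann_sphere \<Rightarrow> complex \<Rightarrow> complex" where
  "field_coeff h p w = 1 / local_coeff h p w"

definition field_order :: "(complex \<Rightarrow> complex) \<Rightarrow> riemann_sphere \<Rightarrow> int" where
  "field_order h p = zorder (field_coeff h p) 0"

definition field_zeros :: "(complex \<Rightarrow> complex) \<Rightarrow> riemann_sphere set" where
  "field_zeros h = {p. field_order h p > 0}"

definition field_value :: "(complex \<Rightarrow> complex) \<Rightarrow> riemann_sphere \<Rightarrow> complex" where
  "field_value h p = remove_sings (field_coeff h p) 0"

text \<open>
  Real-time trajectories defined for all times; they must avoid the poles of the field. Continuity
  on the sphere keeps the curve locally inside the chart in which it is differentiated.
\<close>

definition trajectory :: "(complex \<Rightarrow> complex) \<Rightarrow> (real \<Rightarrow> riemann_sphere) \<Rightarrow> bool" where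
  "trajectory h \<gamma> \<longleftrightarrow>
     continuous_map euclideanreal sphere_topology \<gamma> \<and>
     (\<forall>t. field_order h (\<gamma> t) \<ge> 0 \<and>
          ((\<lambda>s. sphere_coord (\<gamma> t) (\<gamma> s)) has_vector_derivative field_value h (\<gamma> t)) (at t))"

definition closed_trajectory :: "(complex \<Rightarrow> complex) \<Rightarrow> (real \<Rightarrow> riemann_sphere) \<Rightarrow> bool" where
  "closed_trajectory h \<gamma> \<longleftrightarrow>
     trajectory h \<gamma> \<and> (\<exists>t. \<gamma> t \<noteq> \<gamma> 0) \<and> (\<exists>T>0. \<forall>t. \<gamma> (t + T) = \<gamma> t)"

definition is_center :: "(complex \<Rightarrow> complex) \<Rightarrow> riemann_sphere \<Rightarrow> bool" where
  "is_center h p \<longleftrightarrow> p \<in> field_zeros h \<and>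
     (\<exists>U. openin sphere_topology U \<and> p \<in> U \<and>
        (\<forall>q\<in>U - {p}. \<exists>\<gamma>. closed_trajectory h \<gamma> \<and> \<gamma> 0 = q \<and> range \<gamma> \<subseteq> U - {p}))"

definition isochronous :: "(complex \<Rightarrow> complex) \<Rightarrow> bool" where
  "isochronous h \<longleftrightarrow> (\<forall>p\<in>field_zeros h. is_center h p)"

end

theory Submission
  imports Defs "HOL-Computational_Algebra.Fundamental_Theorem_Algebra"
begin

text \<open>
  Let \<open>\<rho>\<close> be the reflection in \<open>E\<close>. The complex conjugate of \<open>\<rho>\<^sup>*\<eta>\<close> is again a rational 1-form.
  Its order at \<open>p\<close> is the order of \<open>\<eta>\<close> at \<open>\<rho> p\<close>. Since \<open>\<rho>\<close> permutes the poles and the zeros of \<open>\<eta>\<close>,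
  and all of them are simple, the two forms have the same order everywhere, so the conjugate of
  \<open>\<rho>\<^sup>*\<eta>\<close> equals \<open>k \<eta>\<close> for a constant \<open>k\<close> (\<open>proportional_if_same_orders\<close>).

  Compare residues at a pole \<open>p\<close> with residue \<open>r\<close>. The conjugate of \<open>\<rho>\<^sup>*\<eta>\<close> has at \<open>p\<close> the conjugate of the
  residue of \<open>\<eta>\<close> at \<open>\<rho> p\<close>. But \<open>\<rho> p\<close> lies in the orbit of \<open>p\<close> under the isotropy group, which preserves
  residues (\<open>isotropy_preserves_residue\<close>), so that residue is \<open>r\<close> as well. Hence
  \<open>cnj r = k * r\<close> with the same \<open>k\<close> at every pole: all residues lie on one real line through \<open>0\<close>
  (\<open>reflection_symmetric_residues\<close>). A rotation by a suitable \<open>\<theta>\<close> turns this line into the imaginary axis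
  (\<open>rotate_to_imaginary\<close>).

  It remains to see that a simple pole with imaginary residue \<open>r\<close> is a center of the vector field
  (\<open>imaginary_residue_center\<close>). There a local coordinate \<open>\<psi>\<close> turns the field into the linear
  field \<open>\<psi> / r\<close> (\<open>simple_pole_linearization\<close>), and because \<open>1 / r\<close> is imaginary its flow consists of
  rotations, whose orbits are closed curves filling a disc.

  Orders and residues are handled together through the leading term \<open>c w\<^sup>n\<close> of a coefficient function
  in a chart centred at the point. For \<open>n = -1\<close> the number \<open>c\<close> is the residue, and it is exactly
  for this \<open>n\<close> that \<open>c\<close> is independent of the chart.
\<close>

section \<open>Leading terms of germs at the origin\<close>

text \<open>
  Since only the punctured germ enters, coefficient functions may be changed on a finite set
  without any care for their values at singularities. The condition \<open>c \<noteq> 0\<close> makes \<open>n\<close> the order.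
\<close>

definition leading_term :: "(complex \<Rightarrow> complex) \<Rightarrow> int \<Rightarrow> complex \<Rightarrow> bool" where
  "leading_term f n c \<longleftrightarrow> c \<noteq> 0 \<and> ((\<lambda>w. f w * w powi (-n)) \<longlongrightarrow> c) (at 0)"

lemma eventually_notin_finite:
  fixes F :: "complex set"
  assumes "finite F"
  shows "eventually (\<lambda>w. w \<notin> F) (at x)"
  using islimpt_finite[OF assms, of x] by (simp add: islimpt_iff_eventually)

lemma leading_term_unique:
  assumes "leading_term f m b" and "leading_term f n c"
  shows "m = n \<and> b = c"
proof -
  have order_le: "n \<le> m" if "leading_term f m b" "leading_term f n c" for m n b c
  proof (rule ccontr)
    assume "\<not> n \<le> m"
    then obtain k where k: "n = m + int k" "k > 0"
      by (metis add.commute add_diff_cancel_left' not_le of_nat_0_less_iff zero_less_imp_eq_int diff_add_cancel diff_gt_0_iff_gt)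
    have "((\<lambda>w. f w * w powi (-n) * w ^ k) \<longlongrightarrow> c * 0 ^ k) (at 0)"
      using that by (intro tendsto_intros) (auto simp: leading_term_def)
    moreover have "eventually (\<lambda>w. f w * w powi (-n) * w ^ k = f w * w powi (-m)) (at 0)"
    proof (rule eventually_mono)
      show "eventually (\<lambda>w. w \<noteq> (0::complex)) (at 0)" by (simp add: eventually_at_filter)
      fix w :: complex assume "w \<noteq> 0"
      then have "w powi (-n) * w ^ k = w powi (-m)"
        using power_int_add[of w "-n" "int k"] k by simp
      then show "f w * w powi (-n) * w ^ k = f w * w powi (-m)" by simp
    qed
    ultimately have "((\<lambda>w. f w * w powi (-m)) \<longlongrightarrow> c * 0 ^ k) (at 0)"
      by (rule Lim_transform_eventually)
    moreover have "((\<lambda>w. f w * w powi (-m)) \<longlongrightarrow> b) (at 0)" "b \<noteq> 0"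
      using that by (auto simp: leading_term_def)
    ultimately show False
      using k(2) tendsto_unique[of "at (0::complex)"] by force
  qed
  have "m = n" using order_le[OF assms] order_le[OF assms(2,1)] by simp
  then show ?thesis
    using assms tendsto_unique[of "at (0::complex)"] by (auto simp: leading_term_def)
qed

lemma leading_term_cong:
  assumes "eventually (\<lambda>w. f w = g w) (at 0)"
  shows "leading_term f n c \<longleftrightarrow> leading_term g n c"
proof -
  have "((\<lambda>w. f w * w powi (-n)) \<longlongrightarrow> c) (at 0) \<longleftrightarrow> ((\<lambda>w. g w * w powi (-n)) \<longlongrightarrow> c) (at 0)"
    by (rule tendsto_cong) (use assms in \<open>auto elim: eventually_mono\<close>)
  then show ?thesis by (simp add: leading_term_def)
qed

lemma leading_term_nonzero:
  assumes "leading_term f n c"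
  shows "\<exists>w. w \<noteq> 0 \<and> f w \<noteq> 0"
proof (rule ccontr)
  assume "\<not> (\<exists>w. w \<noteq> 0 \<and> f w \<noteq> 0)"
  then have "eventually (\<lambda>w. f w * w powi (-n) = 0) (at 0)"
    unfolding eventually_at_filter by (intro always_eventually) auto
  then have "((\<lambda>w. f w * w powi (-n)) \<longlongrightarrow> 0) (at 0)"
    by (rule tendsto_eventually)
  then show False
    using assms tendsto_unique[of "at (0::complex)"] by (auto simp: leading_term_def)
qed

text \<open>
  The link to holomorphic factorizations, and through them to \<open>zorder\<close>.
\<close>

lemma leading_term_factorization:
  assumes e: "e > 0" and u: "u holomorphic_on ball 0 e" "u 0 \<noteq> 0"
    and f: "\<And>w. \<lbrakk>w \<in> ball 0 e; w \<noteq> 0\<rbrakk> \<Longrightarrow> f w = u w * w powi n"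
  shows "leading_term f n (u 0)"
proof -
  have "isCont u 0"
    using e u(1) holomorphic_on_imp_continuous_on continuous_on_eq_continuous_at[of "ball 0 e" u]
    by auto
  then have "(u \<longlongrightarrow> u 0) (at 0)" by (simp add: isCont_def)
  moreover have "eventually (\<lambda>w. u w = f w * w powi (-n)) (at 0)"
    unfolding eventually_at by (rule exI[of _ e]) (use e f in \<open>auto simp: power_int_minus\<close>)
  ultimately have "((\<lambda>w. f w * w powi (-n)) \<longlongrightarrow> u 0) (at 0)"
    by (rule Lim_transform_eventually)
  then show ?thesis using u(2) by (simp add: leading_term_def)
qed

lemma leading_term_mult:
  assumes "leading_term f m b" and "leading_term g n c"
  shows "leading_term (\<lambda>w. f w * g w) (m + n) (b * c)"
proof -
  have "((\<lambda>w. (f w * w powi (-m)) * (g w * w powi (-n))) \<longlongrightarrow> b * c) (at 0)"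
    using assms by (intro tendsto_mult) (auto simp: leading_term_def)
  moreover have "eventually (\<lambda>w. (f w * w powi (-m)) * (g w * w powi (-n))
      = f w * g w * w powi (-(m+n))) (at 0)"
    by (auto simp: eventually_at_filter power_int_diff power_int_minus field_simps power_int_add)
  ultimately have "((\<lambda>w. f w * g w * w powi (-(m+n))) \<longlongrightarrow> b * c) (at 0)"
    by (rule Lim_transform_eventually)
  then show ?thesis using assms by (auto simp: leading_term_def)
qed

lemma leading_term_cmult:
  assumes "leading_term f n c" and "k \<noteq> 0"
  shows "leading_term (\<lambda>w. k * f w) n (k * c)"
  using assms tendsto_mult[OF tendsto_const, of "\<lambda>w. f w * w powi (-n)" c "at 0" k]
  unfolding leading_term_def by (simp add: mult.assoc)

lemma leading_term_cnj:
  assumes "leading_term f n c"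
  shows "leading_term (\<lambda>w. cnj (f (cnj w))) n (cnj c)"
proof -
  have "filterlim cnj (at 0) (at 0)"
    unfolding filterlim_at by (auto intro!: tendsto_eq_intros simp: eventually_at_filter)
  then have "((\<lambda>w. f (cnj w) * cnj w powi (-n)) \<longlongrightarrow> c) (at 0)"
    using assms filterlim_compose unfolding leading_term_def by fast
  then have "((\<lambda>w. cnj (f (cnj w) * cnj w powi (-n))) \<longlongrightarrow> cnj c) (at 0)"
    by (rule tendsto_cnj)
  then show ?thesis using assms by (simp add: leading_term_def)
qed

section \<open>Pullback under fractional linear maps\<close>

text \<open>
  The pullback of \<open>h dz\<close> under \<open>z \<mapsto> (a z + b) / (c z + d)\<close>. The matrix is kept explicit and of
  arbitrary nonzero determinant, so that chart changes, isotropies and reflections are all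
  treated by matrix multiplication; at \<open>c z + d = 0\<close> the value is \<open>0\<close>.
\<close>

definition moebius_pullback :: "complex \<Rightarrow> complex \<Rightarrow> complex \<Rightarrow> complex \<Rightarrow> (complex \<Rightarrow> complex) \<Rightarrow> complex \<Rightarrow> complex"
  where "moebius_pullback a b c d h z = h ((a * z + b) / (c * z + d)) * ((a * d - b * c) / (c * z + d)\<^sup>2)"

text \<open>
  Functoriality of the pullback, as a product of matrices. At \<open>c z + d = 0\<close> it can fail, because
  there the left-hand side is \<open>0\<close> by convention.
\<close>

lemma moebius_pullback_compose:
  assumes "c * z + d \<noteq> 0"
  shows "moebius_pullback a b c d (moebius_pullback a' b' c' d' h) z =
    moebius_pullback (a' * a + b' * c) (a' * b + b' * d) (c' * a + d' * c) (c' * b + d' * d) h z"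
proof -
  define u where "u = (a * z + b) / (c * z + d)"
  have u: "u * (c * z + d) = a * z + b" using assms by (simp add: u_def)
  have den: "(c' * a + d' * c) * z + (c' * b + d' * d) = (c' * u + d') * (c * z + d)"
    using u by algebra
  have num: "(a' * a + b' * c) * z + (a' * b + b' * d) = (a' * u + b') * (c * z + d)"
    using u by algebra
  have det: "(a' * a + b' * c) * (c' * b + d' * d) - (a' * b + b' * d) * (c' * a + d' * c)
    = (a' * d' - b' * c') * (a * d - b * c)"
    by algebra
  show ?thesis
    unfolding moebius_pullback_def den num det u_def[symmetric] using assms
    by (simp add: power_mult_distrib)
qed

text \<open>
  The coefficient in a chart is itself a pullback, under the inverse of the chart. These identities
  hold without exceptional points, by \<open>x / 0 = 0\<close>.
\<close>

lemma local_coeff_Some: "local_coeff h (Some x) = moebius_pullback 1 x 0 1 h"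
  by (rule ext) (simp add: moebius_pullback_def add.commute)

lemma local_coeff_None: "local_coeff h None = moebius_pullback 0 1 1 0 h"
  by (rule ext) (simp add: moebius_pullback_def)

lemma leading_term_local_coeff_cmult:
  assumes "leading_term (local_coeff h p) n r" and "k \<noteq> 0"
  shows "leading_term (local_coeff (\<lambda>z. k * h z) p) n (k * r)"
proof -
  have "local_coeff (\<lambda>z. k * h z) p = (\<lambda>w. k * local_coeff h p w)"
    by (rule ext) (cases p, simp_all)
  then show ?thesis using leading_term_cmult[OF assms] by simp
qed

lemma eventually_affine_nonzero:
  assumes "d \<noteq> 0 \<or> c \<noteq> 0"
  shows "eventually (\<lambda>w. c * w + d \<noteq> (0::complex)) (at z)"
proof (cases "c * z + d = 0")
  case False
  have "((\<lambda>w. c * w + d) \<longlongrightarrow> c * z + d) (at z)" by (intro tendsto_intros)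
  then show ?thesis using False tendsto_imp_eventually_ne by blast
next
  case True
  then have "c \<noteq> 0" using assms by auto
  then have "c * w + d \<noteq> 0" if "w \<noteq> z" for w
    using that True by (metis add_right_cancel mult_left_cancel)
  then show ?thesis by (auto simp: eventually_at_filter)
qed

text \<open>
  Let \<open>M\<close> be the transformation, \<open>A\<close> the inverse chart at \<open>p\<close> and \<open>B\<close> the inverse chart at \<open>M p\<close>. Read in
  these charts, \<open>M\<close> becomes \<open>N = B\<inverse> M A\<close>, which fixes \<open>0\<close>, so the upper right entry of its matrix vanishes.
  The four cases, according to which of \<open>p\<close> and \<open>M p\<close> is infinite, compute this matrix product.
\<close>

lemma local_coeff_moebius_pullback:
  assumes "a * d - b * c \<noteq> 0"
  obtains \<alpha> \<gamma> \<delta> where "\<alpha> \<noteq> 0" "\<delta> \<noteq> 0"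
    "eventually (\<lambda>w. local_coeff (moebius_pullback a b c d h) p w
        = moebius_pullback \<alpha> 0 \<gamma> \<delta> (local_coeff h (moebius_map a b c d p)) w) (at 0)"
proof (cases p)
  case [simp]: (Some x)
  have lhs: "local_coeff (moebius_pullback a b c d h) p w = moebius_pullback a (a * x + b) c (c * x + d) h w" for w
    unfolding Some local_coeff_Some by (subst moebius_pullback_compose) simp_all
  show thesis
  proof (cases "c * x + d = 0")
    case False
    define y where "y = (a * x + b) / (c * x + d)"
    have y: "y * (c * x + d) = a * x + b" using False by (simp add: y_def)
    have M: "moebius_map a b c d p = Some y" using False by (simp add: y_def)
    show thesis
    proof (rule that[of "a - y * c" "c * x + d" c])
      show "a - y * c \<noteq> 0" using assms y False by algebra
      show "eventually (\<lambda>w. local_coeff (moebius_pullback a b c d h) p w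
        = moebius_pullback (a - y * c) 0 c (c * x + d) (local_coeff h (moebius_map a b c d p)) w) (at 0)"
        unfolding M local_coeff_Some lhs
        by (rule eventually_mono[OF eventually_affine_nonzero[of "c * x + d" c 0]])
           (use False in \<open>simp_all add: moebius_pullback_compose y\<close>)
    qed (fact False)
  next
    case True
    have M: "moebius_map a b c d p = None" using True by simp
    show thesis
    proof (rule that[of c "a * x + b" a])
      show "c \<noteq> 0" using assms True by auto
      show 0: "a * x + b \<noteq> 0" using assms True by algebra
      show "eventually (\<lambda>w. local_coeff (moebius_pullback a b c d h) p w
        = moebius_pullback c 0 a (a * x + b) (local_coeff h (moebius_map a b c d p)) w) (at 0)"
        unfolding M local_coeff_None lhs
        by (rule eventually_mono[OF eventually_affine_nonzero[of "a * x + b" a 0]])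
           (use 0 True in \<open>simp_all add: moebius_pullback_compose\<close>)
    qed
  qed
next
  case [simp]: None
  have lhs: "eventually (\<lambda>w. local_coeff (moebius_pullback a b c d h) p w = moebius_pullback b a d c h w) (at 0)"
    unfolding None local_coeff_None
    by (rule eventually_mono[OF eventually_affine_nonzero[of 0 1 0]]) (auto simp: moebius_pullback_compose)
  show thesis
  proof (cases "c = 0")
    case False
    define y where "y = a / c"
    have y: "y * c = a" using False by (simp add: y_def)
    have M: "moebius_map a b c d p = Some y" using False by (simp add: y_def)
    show thesis
    proof (rule that[of "b - y * d" c d])
      show "b - y * d \<noteq> 0" using assms y False by algebra
      show "eventually (\<lambda>w. local_coeff (moebius_pullback a b c d h) p w
        = moebius_pullback (b - y * d) 0 d c (local_coeff h (moebius_map a b c d p)) w) (at 0)"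
        unfolding M local_coeff_Some
        by (rule eventually_elim2[OF lhs eventually_affine_nonzero[of c d 0]])
           (use False in \<open>simp_all add: moebius_pullback_compose y\<close>)
    qed (fact False)
  next
    case True
    have M: "moebius_map a b c d p = None" using True by simp
    show thesis
    proof (rule that[of d a b])
      show "d \<noteq> 0" using assms True by auto
      show 0: "a \<noteq> 0" using assms True by auto
      show "eventually (\<lambda>w. local_coeff (moebius_pullback a b c d h) p w
        = moebius_pullback d 0 b a (local_coeff h (moebius_map a b c d p)) w) (at 0)"
        unfolding M local_coeff_None
        by (rule eventually_elim2[OF lhs eventually_affine_nonzero[of a b 0]])
           (use 0 True in \<open>simp_all add: moebius_pullback_compose\<close>)
    qed
  qed
qed

text \<open>
  The map \<open>N w = \<alpha> w / (\<gamma> w + \<delta>)\<close> behaves like \<open>(\<alpha> / \<delta>) w\<close> near \<open>0\<close>. It contributes \<open>n\<close> factors \<open>\<alpha> / \<delta>\<close> through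
  \<open>N w powi n\<close> and one more through its derivative.
\<close>

lemma leading_term_moebius_pullback_fixing_zero:
  assumes f: "leading_term f n k" and "\<alpha> \<noteq> 0" "\<delta> \<noteq> 0"
  shows "leading_term (moebius_pullback \<alpha> 0 \<gamma> \<delta> f) n (k * (\<alpha> / \<delta>) powi (n + 1))"
proof -
  define N where "N w = \<alpha> * w / (\<gamma> * w + \<delta>)" for w
  define X where "X w = (\<alpha> / (\<gamma> * w + \<delta>)) powi n" for w
  define Y where "Y w = \<alpha> * \<delta> / (\<gamma> * w + \<delta>)\<^sup>2" for w
  have ev: "eventually (\<lambda>w. \<gamma> * w + \<delta> \<noteq> 0 \<and> w \<noteq> 0) (at 0)"
    using eventually_affine_nonzero[of \<delta> \<gamma> 0] eventually_neq_at_within[of 0 0 UNIV] assms(3)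
    by (auto intro: eventually_conj)
  have "((\<lambda>w. \<alpha> * w / (\<gamma> * w + \<delta>)) \<longlongrightarrow> \<alpha> * 0 / (\<gamma> * 0 + \<delta>)) (at 0)"
    using assms by (intro tendsto_intros) auto
  then have "filterlim N (at 0) (at 0)"
    unfolding filterlim_at N_def using assms by (auto intro: eventually_mono[OF ev])
  then have "((\<lambda>w. f (N w) * N w powi (-n)) \<longlongrightarrow> k) (at 0)"
    using f filterlim_compose[of "\<lambda>w. f w * w powi (-n)"] unfolding leading_term_def by blast
  moreover have "(X \<longlongrightarrow> (\<alpha> / (\<gamma> * 0 + \<delta>)) powi n) (at 0)"
    unfolding X_def using assms by (intro tendsto_intros) auto
  moreover have "(Y \<longlongrightarrow> \<alpha> * \<delta> / (\<gamma> * 0 + \<delta>)\<^sup>2) (at 0)"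
    unfolding Y_def using assms by (intro tendsto_intros) auto
  ultimately have lim: "((\<lambda>w. (f (N w) * N w powi (-n)) * (X w * Y w)) \<longlongrightarrow>
      k * ((\<alpha> / (\<gamma> * 0 + \<delta>)) powi n * (\<alpha> * \<delta> / (\<gamma> * 0 + \<delta>)\<^sup>2))) (at 0)"
    by (intro tendsto_mult)
  have coeff: "(\<alpha> / (\<gamma> * 0 + \<delta>)) powi n * (\<alpha> * \<delta> / (\<gamma> * 0 + \<delta>)\<^sup>2) = (\<alpha> / \<delta>) powi (n + 1)"
    using assms by (simp add: power_int_add power2_eq_square)
  have "eventually (\<lambda>w. (f (N w) * N w powi (-n)) * (X w * Y w)
      = moebius_pullback \<alpha> 0 \<gamma> \<delta> f w * w powi (-n)) (at 0)"
  proof (rule eventually_mono[OF ev])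
    fix w assume w: "\<gamma> * w + \<delta> \<noteq> 0 \<and> w \<noteq> 0"
    define t where "t = \<alpha> / (\<gamma> * w + \<delta>)"
    have t: "t \<noteq> 0" "N w = t * w" "X w = t powi n" using w assms by (auto simp: t_def N_def X_def)
    have 1: "N w powi (-n) * X w = w powi (-n)"
      unfolding t(2,3) using t(1) by (simp add: power_int_mult_distrib power_int_minus)
    have 2: "moebius_pullback \<alpha> 0 \<gamma> \<delta> f w = f (N w) * Y w"
      by (simp add: moebius_pullback_def N_def Y_def)
    show "(f (N w) * N w powi (-n)) * (X w * Y w) = moebius_pullback \<alpha> 0 \<gamma> \<delta> f w * w powi (-n)"
      unfolding 2 1[symmetric] by (simp only: ac_simps)
  qed
  then have "((\<lambda>w. moebius_pullback \<alpha> 0 \<gamma> \<delta> f w * w powi (-n)) \<longlongrightarrow> k * (\<alpha> / \<delta>) powi (n + 1)) (at 0)"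
    by (rule Lim_transform_eventually[OF lim[unfolded coeff]])
  then show ?thesis using f assms(2,3) by (simp add: leading_term_def)
qed

text \<open>
  Moebius invariance of the order, and of the residue at a simple pole: for \<open>n = -1\<close> the factor
  \<open>(\<alpha> / \<delta>) powi (n + 1)\<close> disappears.
\<close>

lemma leading_term_moebius_pullback:
  assumes "a * d - b * c \<noteq> 0" and "leading_term (local_coeff h (moebius_map a b c d p)) n k"
  shows "\<exists>k'. leading_term (local_coeff (moebius_pullback a b c d h) p) n k' \<and> (n = -1 \<longrightarrow> k' = k)"
proof -
  obtain \<alpha> \<gamma> \<delta> where *: "\<alpha> \<noteq> 0" "\<delta> \<noteq> 0"
    "eventually (\<lambda>w. local_coeff (moebius_pullback a b c d h) p w
        = moebius_pullback \<alpha> 0 \<gamma> \<delta> (local_coeff h (moebius_map a b c d p)) w) (at 0)"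
    by (rule local_coeff_moebius_pullback[OF assms(1)])
  have "leading_term (local_coeff (moebius_pullback a b c d h) p) n (k * (\<alpha> / \<delta>) powi (n + 1))"
    by (rule leading_term_cong[OF *(3), THEN iffD2, OF leading_term_moebius_pullback_fixing_zero[OF assms(2) *(1,2)]])
  moreover have "n = -1 \<longrightarrow> k * (\<alpha> / \<delta>) powi (n + 1) = k" by simp
  ultimately show ?thesis by (intro exI conjI)
qed

section \<open>Rational coefficient functions\<close>

text \<open>
  Clearing denominators; the exponent \<open>n\<close> can be thought of as the degree of \<open>P\<close>.
\<close>

lemma poly_fractional_linear:
  fixes P :: "complex poly"
  shows "\<exists>R n. \<forall>z. c * z + d \<noteq> 0 \<longrightarrow> poly P ((a * z + b) / (c * z + d)) * (c * z + d) ^ n = poly R z"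
proof (induction P rule: pCons_induct)
  case 0
  show ?case by (rule exI[of _ 0]) simp
next
  case (pCons x P)
  then obtain R n where R: "\<And>z. c * z + d \<noteq> 0 \<Longrightarrow>
      poly P ((a * z + b) / (c * z + d)) * (c * z + d) ^ n = poly R z"
    by blast
  show ?case
  proof (intro exI allI impI)
    fix z assume z: "c * z + d \<noteq> 0"
    have "poly (pCons x P) ((a * z + b) / (c * z + d)) * (c * z + d) ^ Suc n
      = x * (c * z + d) ^ Suc n + (a * z + b) * (poly P ((a * z + b) / (c * z + d)) * (c * z + d) ^ n)"
      using z by (simp add: field_simps)
    also have "\<dots> = poly (smult x ([:d, c:] ^ Suc n) + [:b, a:] * R) z"
      unfolding R[OF z] by (simp add: algebra_simps)
    finally show "poly (pCons x P) ((a * z + b) / (c * z + d)) * (c * z + d) ^ Suc n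
      = poly (smult x ([:d, c:] ^ Suc n) + [:b, a:] * R) z" .
  qed
qed

lemma rational_form_moebius_pullback:
  assumes h: "rational_form h" and det: "a * d - b * c \<noteq> 0"
  shows "rational_form (moebius_pullback a b c d h)"
proof -
  obtain P Q where Q: "Q \<noteq> 0" and h_eq: "\<And>z. h z = poly P z / poly Q z"
    using h by (auto simp: rational_form_def)
  let ?M = "\<lambda>z. (a * z + b) / (c * z + d)"
  obtain R m where R: "\<And>z. c * z + d \<noteq> 0 \<Longrightarrow> poly P (?M z) * (c * z + d) ^ m = poly R z"
    using poly_fractional_linear[where P = P] by blast
  obtain S n where S: "\<And>z. c * z + d \<noteq> 0 \<Longrightarrow> poly Q (?M z) * (c * z + d) ^ n = poly S z"
    using poly_fractional_linear[where P = Q] by blast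
  have cd: "[:d, c:] \<noteq> 0" using det by auto
  \<comment> \<open>If \<open>S\<close> vanished, \<open>Q\<close> would vanish on the image of the transformation, which is infinite.\<close>
  have "S \<noteq> 0"
  proof
    assume "S = 0"
    then have sub: "?M ` {z. poly [:d, c:] z \<noteq> 0} \<subseteq> {z. poly Q z = 0}"
      using S by (auto simp: add.commute mult.commute)
    have "inj_on ?M {z. poly [:d, c:] z \<noteq> 0}"
    proof (rule inj_onI)
      fix x y assume "x \<in> {z. poly [:d, c:] z \<noteq> 0}" "y \<in> {z. poly [:d, c:] z \<noteq> 0}" "?M x = ?M y"
      then have "(a * x + b) * (c * y + d) = (a * y + b) * (c * x + d)"
        by (simp add: frac_eq_eq add.commute mult.commute)
      then have "(a * d - b * c) * (x - y) = 0" by algebra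
      then show "x = y" using det by simp
    qed
    then have "finite {z. poly [:d, c:] z \<noteq> 0}"
      using finite_subset[OF sub poly_roots_finite[OF Q]] finite_imageD by blast
    then have "finite ({z. poly [:d, c:] z \<noteq> 0} \<union> {z. poly [:d, c:] z = 0})"
      using poly_roots_finite[OF cd] by blast
    moreover have "{z. poly [:d, c:] z \<noteq> 0} \<union> {z. poly [:d, c:] z = 0} = UNIV" by blast
    ultimately show False using infinite_UNIV_char_0[where 'a = complex] by argo
  qed
  define L where "L = [:d, c:]"
  have L: "L \<noteq> 0" "poly L z = c * z + d" for z using det by (auto simp: L_def)
  show ?thesis
    unfolding rational_form_def
  proof (intro exI conjI allI)
    \<comment> \<open>The exponent \<open>m + 2\<close> is positive, so the quotient is \<open>0\<close> at the zero of \<open>L\<close>, as is the pullback.\<close>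
    show "S * L ^ (m + 2) \<noteq> 0" using \<open>S \<noteq> 0\<close> L by simp
    fix z
    show "moebius_pullback a b c d h z = poly (smult (a * d - b * c) (R * L ^ n)) z / poly (S * L ^ (m + 2)) z"
    proof (cases "c * z + d = 0")
      case True
      then show ?thesis by (simp add: moebius_pullback_def L)
    next
      case False
      then show ?thesis
        by (simp add: moebius_pullback_def h_eq L R[OF False, symmetric] S[OF False, symmetric] power_add power2_eq_square)
    qed
  qed
qed

lemma rational_form_local_coeff:
  assumes "rational_form h"
  shows "rational_form (local_coeff h p)"
proof (cases p)
  case None
  then show ?thesis
    using rational_form_moebius_pullback[OF assms, of 0 0 1 1] by (simp add: local_coeff_None)
next
  case (Some x)
  then show ?thesis
    using rational_form_moebius_pullback[OF assms, of 1 1 x 0] by (simp add: local_coeff_Some)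
qed

lemma rational_form_cnj:
  assumes "rational_form h"
  shows "rational_form (\<lambda>z. cnj (h (cnj z)))"
proof -
  obtain P Q where Q: "Q \<noteq> 0" and h: "\<And>z. h z = poly P z / poly Q z"
    using assms by (auto simp: rational_form_def)
  have "map_poly cnj Q \<noteq> 0"
    using Q by (subst map_poly_eq_0_iff) auto
  moreover have "cnj (h (cnj z)) = poly (map_poly cnj P) z / poly (map_poly cnj Q) z" for z
    using poly_cnj[of P "cnj z"] poly_cnj[of Q "cnj z"] by (simp add: h)
  ultimately show ?thesis unfolding rational_form_def by blast
qed

lemma rational_form_cmult:
  assumes "rational_form h"
  shows "rational_form (\<lambda>z. k * h z)"
proof -
  obtain P Q where "Q \<noteq> 0" "\<And>z. h z = poly P z / poly Q z"
    using assms by (auto simp: rational_form_def)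
  then have "Q \<noteq> 0" "\<And>z. k * h z = poly (smult k P) z / poly Q z"
    by auto
  then show ?thesis unfolding rational_form_def by blast
qed

text \<open>
  The identity theorem in the form needed at infinity: agreement near one finite point leaves only
  finitely many exceptions, hence none near \<open>\<infinity>\<close>. Agreement off a sparse subset of the plane would not
  give this for arbitrary functions, as such a set may accumulate at \<open>\<infinity>\<close>.
\<close>

lemma rational_form_eventually_eq:
  assumes f: "rational_form f" and g: "rational_form g" and eq: "eventually (\<lambda>w. f w = g w) (at x)"
  shows "finite {z. f z \<noteq> g z}"
proof -
  obtain P Q where Q: "Q \<noteq> 0" "\<And>z. f z = poly P z / poly Q z"
    using f by (auto simp: rational_form_def)
  obtain R S where S: "S \<noteq> 0" "\<And>z. g z = poly R z / poly S z"
    using g by (auto simp: rational_form_def)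
  have QS: "finite {z. poly (Q * S) z = 0}" using Q S poly_roots_finite[of "Q * S"] by simp
  have "P * S - R * Q = 0"
  proof (rule ccontr)
    assume "P * S - R * Q \<noteq> 0"
    then have fin: "finite {z. poly (P * S - R * Q) z = 0}" by (rule poly_roots_finite)
    have "eventually (\<lambda>w. w \<notin> {z. poly (Q * S) z = 0} \<union> {z. poly (P * S - R * Q) z = 0}) (at x)"
      using QS fin by (intro eventually_notin_finite finite_UnI)
    then have "eventually (\<lambda>w. False) (at x)"
      using eq
    proof eventually_elim
      case (elim w)
      then have "poly P w * poly S w = poly R w * poly Q w"
        by (simp add: Q(2) S(2) frac_eq_eq)
      then show ?case using elim by simp
    qed
    then show False by simp
  qed
  then have PS: "P * S = R * Q" by simp
  have "f z = g z" if "poly (Q * S) z \<noteq> 0" for z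
    using that arg_cong[OF PS, of "\<lambda>p. poly p z"] by (simp add: Q(2) S(2) frac_eq_eq)
  then have "{z. f z \<noteq> g z} \<subseteq> {z. poly (Q * S) z = 0}" by blast
  then show ?thesis using QS finite_subset by blast
qed

section \<open>Orders of rational forms\<close>

lemma rational_form_zero:
  assumes h: "rational_form h" and fin: "finite {z. h z \<noteq> 0}"
  shows "h z = 0"
proof -
  obtain P Q where Q: "Q \<noteq> 0" and h_eq: "\<And>z. h z = poly P z / poly Q z"
    using h by (auto simp: rational_form_def)
  have "P * Q = 0"
  proof (rule ccontr)
    assume "P * Q \<noteq> 0"
    then have "finite ({z. poly (P * Q) z = 0} \<union> {z. h z \<noteq> 0})"
      using fin poly_roots_finite by blast
    moreover have "{z. poly (P * Q) z = 0} \<union> {z. h z \<noteq> 0} = UNIV"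
      by (auto simp: h_eq)
    ultimately show False using infinite_UNIV_char_0[where 'a = complex] by argo
  qed
  then show ?thesis using Q h_eq by simp
qed

lemma local_coeff_nonzero:
  assumes h: "rational_form h" and z: "h z \<noteq> 0"
  obtains w where "local_coeff h p w \<noteq> 0"
proof (cases p)
  case (Some a)
  then have "local_coeff h p (z - a) \<noteq> 0" using z by simp
  then show thesis by (rule that)
next
  case None
  have "\<not> {z. h z \<noteq> 0} \<subseteq> {0}"
    using rational_form_zero[OF h] z finite_subset by blast
  then obtain v where "h v \<noteq> 0" "v \<noteq> 0" by blast
  then have "local_coeff h p (1 / v) \<noteq> 0" using None by simp
  then show thesis by (rule that)
qed

lemma rational_form_local_factorization:
  assumes f: "rational_form f" and z: "f z \<noteq> 0"
  obtains u e where "e > 0" "u holomorphic_on ball 0 e" "\<And>w. w \<in> ball 0 e \<Longrightarrow> u w \<noteq> 0"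
    "\<And>w. \<lbrakk>w \<in> ball 0 e; w \<noteq> 0\<rbrakk> \<Longrightarrow> f w = u w * w powi zorder f 0"
proof -
  obtain P Q where Q: "Q \<noteq> 0" and f_eq: "\<And>z. f z = poly P z / poly Q z"
    using f by (auto simp: rational_form_def)
  have P: "P \<noteq> 0" using z f_eq by auto
  define m k where "m = order 0 P" and "k = order 0 Q"
  obtain p where p: "P = [:- 0, 1:] ^ m * p" "\<not> [:- 0, 1:] dvd p"
    using order_decomp[OF P, of 0] by (auto simp: m_def)
  obtain q where q: "Q = [:- 0, 1:] ^ k * q" "\<not> [:- 0, 1:] dvd q"
    using order_decomp[OF Q, of 0] by (auto simp: k_def)
  have pq0: "poly (p * q) 0 \<noteq> 0" using p(2) q(2) by (simp add: poly_eq_0_iff_dvd)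
  have "open (poly (p * q) -` (- {0}))"
    by (intro open_vimage continuous_intros)
  then obtain e where e: "e > 0" "ball 0 e \<subseteq> poly (p * q) -` (- {0})"
    using pq0 open_contains_ball by (metis (no_types, lifting) Compl_iff singletonD vimageI)
  define u where "u w = poly p w / poly q w" for w
  have nz: "poly p w \<noteq> 0" "poly q w \<noteq> 0" if "w \<in> ball 0 e" for w
    using e(2) that by auto
  have hol: "u holomorphic_on ball 0 e"
    unfolding u_def by (intro holomorphic_intros) (use nz in auto)
  have eq: "f w = u w * w powi (int m - int k)" if "w \<in> ball 0 e" "w \<noteq> 0" for w
    using that(2) by (simp add: f_eq p(1) q(1) u_def poly_power power_int_diff mult.commute)
  have "zorder f 0 = int m - int k"
    by (rule zorder_eqI[OF open_ball _ hol]) (use e(1) nz eq in \<open>auto simp: u_def\<close>)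
  with eq nz show thesis
    by (intro that[OF e(1) hol]) (auto simp: u_def)
qed

lemma form_leading_term:
  assumes h: "rational_form h" and z: "h z \<noteq> 0"
  shows "\<exists>c. leading_term (local_coeff h p) (form_order h p) c"
proof -
  obtain v where v: "local_coeff h p v \<noteq> 0" by (rule local_coeff_nonzero[OF h z])
  obtain u e where u: "e > 0" "u holomorphic_on ball 0 e" "\<And>w. w \<in> ball 0 e \<Longrightarrow> u w \<noteq> 0"
    "\<And>w. \<lbrakk>w \<in> ball 0 e; w \<noteq> 0\<rbrakk> \<Longrightarrow> local_coeff h p w = u w * w powi form_order h p"
    by (rule rational_form_local_factorization[OF rational_form_local_coeff[OF h] v, folded form_order_def])
       (rule that)
  have "u 0 \<noteq> 0" using u(1,3) by simp
  then have "leading_term (local_coeff h p) (form_order h p) (u 0)"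
    using leading_term_factorization[OF u(1,2)] u(4) by blast
  then show ?thesis ..
qed

lemma form_nonzero_if_leading_term:
  assumes "leading_term (local_coeff h p) n c"
  shows "\<exists>z. h z \<noteq> 0"
proof -
  obtain w where "local_coeff h p w \<noteq> 0" using leading_term_nonzero[OF assms] by blast
  then show ?thesis by (cases p) auto
qed

lemma form_order_eqI:
  assumes "rational_form h" and "leading_term (local_coeff h p) n c"
  shows "form_order h p = n"
proof -
  obtain z where "h z \<noteq> 0" using form_nonzero_if_leading_term[OF assms(2)] by blast
  then show ?thesis
    using form_leading_term[OF assms(1), of _ p] leading_term_unique[OF assms(2)] by metis
qed

lemma leading_term_poly:
  assumes "P \<noteq> 0"
  shows "\<exists>c. leading_term (\<lambda>w. poly P (a + w)) (int (order a P)) c"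
proof -
  obtain p where p: "P = [:- a, 1:] ^ order a P * p" "\<not> [:- a, 1:] dvd p"
    using order_decomp[OF assms] by blast
  have eq: "poly P (a + w) = w ^ order a P * poly p (a + w)" for w
    by (subst p(1)) (simp add: poly_power)
  have "((\<lambda>w. poly p (a + w)) \<longlongrightarrow> poly p (a + 0)) (at 0)"
    by (intro tendsto_intros)
  moreover have "eventually (\<lambda>w. poly p (a + w) = poly P (a + w) * w powi (- int (order a P))) (at 0)"
    unfolding eq by (auto simp: eventually_at_filter power_int_minus)
  ultimately have "((\<lambda>w. poly P (a + w) * w powi (- int (order a P))) \<longlongrightarrow> poly p (a + 0)) (at 0)"
    by (rule Lim_transform_eventually)
  moreover have "poly p (a + 0) \<noteq> 0" using p(2) by (simp add: poly_eq_0_iff_dvd)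
  ultimately show ?thesis by (auto simp: leading_term_def)
qed

lemma form_order_Some_quotient:
  assumes P: "P \<noteq> 0" and Q: "Q \<noteq> 0" and f: "\<And>z. f z = poly P z / poly Q z"
  shows "form_order f (Some a) = int (order a P) - int (order a Q)"
proof -
  obtain b where b: "leading_term (\<lambda>w. poly P (a + w)) (int (order a P)) b"
    using leading_term_poly[OF P] by blast
  obtain c where c: "leading_term (\<lambda>w. poly Q (a + w)) (int (order a Q)) c"
    using leading_term_poly[OF Q] by blast
  have rf: "rational_form f" using Q f unfolding rational_form_def by blast
  have "\<exists>z. f z \<noteq> 0"
  proof (rule ccontr)
    assume "\<not> (\<exists>z. f z \<noteq> 0)"
    then have "poly (P * Q) z = 0" for z using f[of z] by auto
    then have "P * Q = 0" using poly_all_0_iff_0 by blast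
    then show False using P Q by simp
  qed
  then obtain d where d: "leading_term (local_coeff f (Some a)) (form_order f (Some a)) d"
    using form_leading_term[OF rf] by blast
  have fin: "finite {z. poly Q z = 0}" using Q by (rule poly_roots_finite)
  have "eventually (\<lambda>w. poly Q w \<noteq> 0) (at a)"
    using eventually_notin_finite[OF fin, of a] by simp
  then have "eventually (\<lambda>w. poly Q (a + w) \<noteq> 0) (at 0)"
    by (subst (asm) eventually_at_to_0) (simp add: add.commute)
  then have "eventually (\<lambda>w. local_coeff f (Some a) w * poly Q (a + w) = poly P (a + w)) (at 0)"
    by eventually_elim (simp add: f)
  from leading_term_cong[OF this] leading_term_mult[OF d c]
  have "leading_term (\<lambda>w. poly P (a + w)) (form_order f (Some a) + int (order a Q)) (d * c)" by blast
  from leading_term_unique[OF this b] show ?thesis by simp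
qed

text \<open>
  A polynomial is determined up to a constant by the orders of its roots. For \<open>f = P / Q\<close> and
  \<open>g = R / S\<close> equality of the orders at finite points says that \<open>P S\<close> and \<open>R Q\<close> have the same roots
  with multiplicities.
\<close>

lemma proportional_if_same_orders:
  assumes f: "rational_form f" and g: "rational_form g"
    and z: "f z \<noteq> 0" and w: "g w \<noteq> 0"
    and order_eq: "\<And>a. form_order f (Some a) = form_order g (Some a)"
  obtains k where "k \<noteq> 0" "finite {z. g z \<noteq> k * f z}"
proof -
  obtain P Q where Q: "Q \<noteq> 0" and f_eq: "\<And>z. f z = poly P z / poly Q z"
    using f by (auto simp: rational_form_def)
  obtain R S where S: "S \<noteq> 0" and g_eq: "\<And>z. g z = poly R z / poly S z"
    using g by (auto simp: rational_form_def)
  have P: "P \<noteq> 0" and R: "R \<noteq> 0" using z w f_eq g_eq by auto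
  have "order a (P * S) = order a (R * Q)" for a
    using order_eq[of a] P Q R S
    by (simp add: form_order_Some_quotient[OF P Q f_eq] form_order_Some_quotient[OF R S g_eq] order_mult)
  moreover have "{z. poly (P * S) z = 0} = {z. poly (R * Q) z = 0}"
    using calculation P Q R S order_root by (metis mult_eq_0_iff)
  ultimately have same: "(\<Prod>z|poly (P * S) z = 0. [:-z, 1:] ^ order z (P * S))
      = (\<Prod>z|poly (R * Q) z = 0. [:-z, 1:] ^ order z (R * Q))"
    by simp
  define D where "D = (\<Prod>z|poly (P * S) z = 0. [:-z, 1:] ^ order z (P * S))"
  define k where "k = lead_coeff (R * Q) / lead_coeff (P * S)"
  have k: "k \<noteq> 0" using P Q R S by (simp add: k_def)
  have "P * S = smult (lead_coeff (P * S)) D"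
    unfolding D_def by (rule complex_poly_decompose[symmetric])
  moreover have "R * Q = smult (lead_coeff (R * Q)) D"
    unfolding D_def same by (rule complex_poly_decompose[symmetric])
  moreover have "lead_coeff (R * Q) = k * lead_coeff (P * S)" using P S by (simp add: k_def)
  ultimately have RQ: "R * Q = smult k (P * S)" by (metis smult_smult)
  have "g z = k * f z" if "poly (Q * S) z \<noteq> 0" for z
    using that arg_cong[OF RQ, of "\<lambda>p. poly p z"] by (simp add: f_eq g_eq frac_eq_eq)
  then have "{z. g z \<noteq> k * f z} \<subseteq> {z. poly (Q * S) z = 0}" by blast
  moreover have "finite {z. poly (Q * S) z = 0}" using Q S poly_roots_finite[of "Q * S"] by simp
  ultimately show thesis using that[OF k] finite_subset by blast
qed

section \<open>Residues under the isotropy group\<close>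

lemma moebius_map_inverse:
  assumes "a * d - b * c = 1"
  shows "moebius_map d (-b) (-c) a (moebius_map a b c d p) = p"
proof (cases p)
  case None
  then show ?thesis using assms by (auto simp: field_simps)
next
  case (Some z)
  show ?thesis
  proof (cases "c * z + d = 0")
    case True
    then have "c \<noteq> 0" "d = - c * z" using assms by (auto simp: add_eq_0_iff)
    then show ?thesis using Some by (auto simp: field_simps)
  next
    case False
    define u where "u = (a * z + b) / (c * z + d)"
    have u: "u * (c * z + d) = a * z + b" using False by (simp add: u_def)
    have den: "(a - c * u) * (c * z + d) = 1" using u assms by algebra
    have num: "(d * u - b) * (c * z + d) = z" using u assms by algebra
    have "a - c * u \<noteq> 0" using den by auto
    moreover have "(d * u - b) / (a - c * u) = z"
      using den num calculation by (metis False mult_cancel_right nonzero_divide_eq_eq mult.commute mult.assoc mult_1)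
    ultimately show ?thesis using Some False by (simp add: u_def)
  qed
qed

lemma inv_moebius_map:
  assumes "a * d - b * c = 1"
  shows "inv (moebius_map a b c d) = moebius_map d (-b) (-c) a"
proof (rule inv_equality)
  show "moebius_map d (-b) (-c) a (moebius_map a b c d p) = p" for p
    by (rule moebius_map_inverse[OF assms])
  show "moebius_map a b c d (moebius_map d (-b) (-c) a p) = p" for p
    using moebius_map_inverse[of d a "-b" "-c" p] assms by (simp add: mult.commute)
qed

lemma pullback_moebius_map:
  assumes "c * z + d \<noteq> 0"
  shows "pullback (moebius_map a b c d) h z = moebius_pullback a b c d h z"
proof -
  have "eventually (\<lambda>u. c * u + d \<noteq> 0) (nhds z)"
  proof (rule eventually_nhds_in_open[of "{u. c * u + d \<noteq> 0}", simplified])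
    show "open {u. c * u + d \<noteq> 0}"
      by (intro open_Collect_neq continuous_intros)
  qed (rule assms)
  then have "eventually (\<lambda>u. the (moebius_map a b c d (Some u)) = (a * u + b) / (c * u + d)) (nhds z)"
    by eventually_elim simp
  then have "deriv (\<lambda>u. the (moebius_map a b c d (Some u))) z = deriv (\<lambda>u. (a * u + b) / (c * u + d)) z"
    by (rule deriv_cong_ev) simp
  also have "\<dots> = (a * d - b * c) / (c * z + d)\<^sup>2"
    using assms by (intro DERIV_imp_deriv)
       (auto intro!: derivative_eq_intros simp: power2_eq_square algebra_simps)
  finally show ?thesis using assms by (simp add: pullback_def moebius_pullback_def)
qed

lemma local_coeff_eventually_eq:
  assumes fin: "finite {z. f z \<noteq> g z}"
  shows "eventually (\<lambda>w. local_coeff f p w = local_coeff g p w) (at 0)"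
proof -
  have "\<exists>F. finite F \<and> {w. local_coeff f p w \<noteq> local_coeff g p w} \<subseteq> F"
  proof (cases p)
    case (Some a)
    have "{w. local_coeff f p w \<noteq> local_coeff g p w} \<subseteq> (\<lambda>z. z - a) ` {z. f z \<noteq> g z}"
      using Some by (auto intro!: image_eqI[of _ _ "a + _"])
    then show ?thesis using fin by blast
  next
    case None
    have "{w. local_coeff f p w \<noteq> local_coeff g p w} \<subseteq> (\<lambda>z. 1 / z) ` {z. f z \<noteq> g z}"
      using None by (auto intro!: image_eqI[of _ _ "1 / _"])
    then show ?thesis using fin by blast
  qed
  then obtain F where F: "finite F" "{w. local_coeff f p w \<noteq> local_coeff g p w} \<subseteq> F" by blast
  show ?thesis
    using eventually_notin_finite[OF F(1)] by eventually_elim (use F(2) in blast)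
qed

text \<open>
  Pulling \<open>\<eta>\<close> back under \<open>T\<inverse>\<close> carries the residue at \<open>p\<close> to the residue at \<open>T p\<close>, and the pulled back
  form is \<open>\<eta>\<close> again. When \<open>T p = \<infinity>\<close> this uses that two rational forms that agree off a sparse set
  agree off a finite one.
\<close>

lemma isotropy_preserves_residue:
  assumes h: "rational_form h" and T: "T \<in> isotropy_group h"
    and r: "leading_term (local_coeff h p) (-1) r"
  shows "leading_term (local_coeff h (T p)) (-1) r"
proof -
  from T obtain a b c d where det: "a * d - b * c = 1" and T_eq: "T = moebius_map a b c d"
    by (auto simp: isotropy_group_def PSL2C_def)
  define g where "g = moebius_pullback d (-b) (-c) a h"
  have "eventually (\<lambda>z. pullback (inv T) h z = h z) (cosparse UNIV)"
    using T by (simp add: isotropy_group_def form_eq_def pushforward_def)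
  then have "eventually (\<lambda>z. pullback (inv T) h z = h z) (at 0)"
    by (rule eventually_cosparse_imp_eventually_at) simp
  moreover have "eventually (\<lambda>z. - c * z + a \<noteq> 0) (at 0)"
    by (rule eventually_affine_nonzero) (use det in auto)
  ultimately have "eventually (\<lambda>z. g z = h z) (at 0)"
    by eventually_elim (simp add: T_eq inv_moebius_map[OF det] pullback_moebius_map g_def)
  moreover have "rational_form g"
    unfolding g_def by (rule rational_form_moebius_pullback[OF h]) (use det in \<open>simp add: mult.commute\<close>)
  ultimately have fin: "finite {z. g z \<noteq> h z}"
    using rational_form_eventually_eq h by blast
  have "leading_term (local_coeff h (moebius_map d (-b) (-c) a (T p))) (-1) r"
    using r moebius_map_inverse[OF det] by (simp add: T_eq)
  then have "leading_term (local_coeff g (T p)) (-1) r"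
    using leading_term_moebius_pullback[of d a "-b" "-c" h "T p" "-1" r] det
    by (auto simp: g_def mult.commute)
  then show ?thesis
    using leading_term_cong[OF local_coeff_eventually_eq[OF fin]] by blast
qed

section \<open>The conjugate of the reflected form\<close>

lemma circle_reflection_moebius_map:
  assumes "is_circle E"
  obtains a b c d where "a * d - b * c \<noteq> 0" "circle_reflection E = moebius_map a b c d \<circ> map_option cnj"
  using assms unfolding is_circle_def
proof (elim disjE exE conjE)
  fix c r assume r: "(r::real) > 0" and E: "E = Some ` sphere c r"
  show thesis
  proof (rule that)
    show "c * (- cnj c) - (of_real (r^2) - c * cnj c) * 1 \<noteq> 0" using r by simp
    show "circle_reflection E = moebius_map c (of_real (r^2) - c * cnj c) 1 (- cnj c) \<circ> map_option cnj"
    proof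
      fix p show "circle_reflection E p = (moebius_map c (of_real (r^2) - c * cnj c) 1 (- cnj c) \<circ> map_option cnj) p"
        by (cases p) (auto simp: circle_reflection_circle[OF r E] field_simps)
    qed
  qed
next
  fix a u assume u: "u \<noteq> 0" and E: "E = insert None (Some ` range (\<lambda>t::real. a + of_real t * u))"
  show thesis
  proof (rule that)
    show "(u / cnj u) * 1 - (a - u * cnj a / cnj u) * 0 \<noteq> 0" using u by simp
    show "circle_reflection E = moebius_map (u / cnj u) (a - u * cnj a / cnj u) 0 1 \<circ> map_option cnj"
    proof
      fix p show "circle_reflection E p = (moebius_map (u / cnj u) (a - u * cnj a / cnj u) 0 1 \<circ> map_option cnj) p"
        using u by (cases p) (auto simp: circle_reflection_line[OF u E] field_simps)
    qed
  qed
qed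

lemma circle_reflection_involution:
  assumes "is_circle E"
  shows "circle_reflection E (circle_reflection E p) = p"
  using assms unfolding is_circle_def
proof (elim disjE exE conjE)
  fix c r assume r: "(r::real) > 0" and E: "E = Some ` sphere c r"
  show ?thesis
    using r by (cases p) (auto simp: circle_reflection_circle[OF r E])
next
  fix a u assume u: "u \<noteq> 0" and E: "E = insert None (Some ` range (\<lambda>t::real. a + of_real t * u))"
  show ?thesis
    using u by (cases p) (auto simp: circle_reflection_line[OF u E])
qed

lemma local_coeff_cnj:
  "local_coeff (\<lambda>z. cnj (h (cnj z))) (map_option cnj p) w = cnj (local_coeff h p (cnj w))"
  by (cases p) auto

lemma map_option_cnj_moebius_map:
  "map_option cnj (moebius_map a b c d (map_option cnj p)) = moebius_map (cnj a) (cnj b) (cnj c) (cnj d) p"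
proof (cases p)
  case (Some z)
  have "c * cnj z + d = 0 \<longleftrightarrow> cnj c * z + cnj d = 0"
    by (metis complex_cnj_add complex_cnj_cnj complex_cnj_mult complex_cnj_zero_iff)
  then show ?thesis using Some by auto
qed auto

text \<open>
  With \<open>\<rho> = M \<circ> cnj\<close> for the transformation \<open>M\<close> of matrix \<open>a, b, c, d\<close>, this is the coefficient of the
  complex conjugate of \<open>\<rho>\<^sup>*(h dz)\<close>: conjugating \<open>h(\<rho> z)\<close> gives the conjugate coefficient function
  \<open>cnj \<circ> h \<circ> cnj\<close> at \<open>cnj (\<rho> z)\<close>, and \<open>cnj \<circ> \<rho>\<close> is the holomorphic transformation with conjugate matrix.
\<close>

definition reflected_form :: "complex \<Rightarrow> complex \<Rightarrow> complex \<Rightarrow> complex \<Rightarrow> (complex \<Rightarrow> complex) \<Rightarrow> complex \<Rightarrow> complex"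
  where "reflected_form a b c d h = moebius_pullback (cnj a) (cnj b) (cnj c) (cnj d) (\<lambda>z. cnj (h (cnj z)))"

lemma rational_form_reflected:
  assumes "rational_form h" and "a * d - b * c \<noteq> 0"
  shows "rational_form (reflected_form a b c d h)"
  unfolding reflected_form_def
proof (rule rational_form_moebius_pullback[OF rational_form_cnj[OF assms(1)]])
  have "cnj a * cnj d - cnj b * cnj c = cnj (a * d - b * c)" by simp
  then show "cnj a * cnj d - cnj b * cnj c \<noteq> 0" using assms(2) complex_cnj_zero_iff by metis
qed

lemma leading_term_reflected:
  assumes det: "a * d - b * c \<noteq> 0"
    and k: "leading_term (local_coeff h (moebius_map a b c d (map_option cnj p))) n k"
  shows "\<exists>k'. leading_term (local_coeff (reflected_form a b c d h) p) n k' \<and> (n = -1 \<longrightarrow> k' = cnj k)"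
  unfolding reflected_form_def
proof (rule leading_term_moebius_pullback)
  have "cnj a * cnj d - cnj b * cnj c = cnj (a * d - b * c)" by simp
  then show "cnj a * cnj d - cnj b * cnj c \<noteq> 0" using det complex_cnj_zero_iff by metis
  show "leading_term (local_coeff (\<lambda>z. cnj (h (cnj z))) (moebius_map (cnj a) (cnj b) (cnj c) (cnj d) p)) n (cnj k)"
    using leading_term_cnj[OF k]
    by (subst map_option_cnj_moebius_map[symmetric]) (simp add: local_coeff_cnj[abs_def])
qed

text \<open>
  The conjugate of the reflected form has the same orders as \<open>h\<close>, hence equals \<open>k h\<close>. Its residue at
  a pole \<open>p\<close> is \<open>cnj r\<close> by invariance of the residues under the reflection, and \<open>k r\<close> by
  proportionality.
\<close>

lemma reflection_symmetric_residues:
  assumes h: "rational_form h" and z: "h z \<noteq> 0" and E: "is_circle E"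
    and orders: "\<And>p. form_order h (circle_reflection E p) = form_order h p"
    and residues: "\<And>p r. leading_term (local_coeff h p) (-1) r \<Longrightarrow>
      leading_term (local_coeff h (circle_reflection E p)) (-1) r"
  obtains k where "\<And>p r. leading_term (local_coeff h p) (-1) r \<Longrightarrow> cnj r = k * r"
proof -
  obtain a b c d where det: "a * d - b * c \<noteq> 0"
    and \<rho>: "circle_reflection E = moebius_map a b c d \<circ> map_option cnj"
    by (rule circle_reflection_moebius_map[OF E])
  define g where "g = reflected_form a b c d h"
  have g: "rational_form g" unfolding g_def by (rule rational_form_reflected[OF h det])
  have g_lead: "\<exists>k. leading_term (local_coeff g p) (form_order h p) k" for p
  proof -
    obtain k where "leading_term (local_coeff h (circle_reflection E p)) (form_order h p) k"
      using form_leading_term[OF h z, of "circle_reflection E p"] orders by auto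
    then show ?thesis
      using leading_term_reflected[OF det, of h p] unfolding g_def \<rho> comp_def by blast
  qed
  have g_order: "form_order h p = form_order g p" for p
    using g_lead[of p] form_order_eqI[OF g] by metis
  obtain w where w: "g w \<noteq> 0" using g_lead form_nonzero_if_leading_term by blast
  obtain k where k: "k \<noteq> 0" and fin: "finite {z. g z \<noteq> k * h z}"
    by (rule proportional_if_same_orders[OF h g z w g_order])
  show thesis
  proof (rule that)
    fix p r assume r: "leading_term (local_coeff h p) (-1) r"
    have "leading_term (local_coeff g p) (-1) (cnj r)"
      using leading_term_reflected[OF det, of h p "-1" r] residues[OF r]
      unfolding g_def \<rho> comp_def by auto
    moreover have "leading_term (local_coeff (\<lambda>z. k * h z) p) (-1) (k * r)"
      by (rule leading_term_local_coeff_cmult[OF r k])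
    then have "leading_term (local_coeff g p) (-1) (k * r)"
      using leading_term_cong[OF local_coeff_eventually_eq[OF fin]] by blast
    ultimately show "cnj r = k * r"
      using leading_term_unique by blast
  qed
qed

section \<open>Trajectories in charts\<close>

lemma field_at_regular_point:
  assumes h: "rational_form h" and z: "h z \<noteq> 0"
  shows "field_order h (Some z) = 0" and "field_value h (Some z) = 1 / h z"
proof -
  obtain P Q where Q: "Q \<noteq> 0" and h_eq: "\<And>z. h z = poly P z / poly Q z"
    using h by (auto simp: rational_form_def)
  have fc: "field_coeff h (Some z) = (\<lambda>w. poly Q (z + w) / poly P (z + w))"
    by (rule ext) (simp add: field_coeff_def h_eq)
  have poly_an: "(\<lambda>w. poly R (z + w)) analytic_on {0}" for R
  proof -
    have "(\<lambda>w. poly (pcompose R [:z, 1:]) w) holomorphic_on UNIV" by (intro holomorphic_intros)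
    then have "(\<lambda>w. poly R (z + w)) holomorphic_on UNIV" by (simp add: poly_pcompose)
    then show ?thesis using analytic_on_open[of UNIV] analytic_on_subset by blast
  qed
  have "poly P (z + 0) \<noteq> 0" using z by (auto simp: h_eq)
  then have an: "field_coeff h (Some z) analytic_on {0}"
    unfolding fc by (intro analytic_on_divide poly_an) auto
  have val: "field_coeff h (Some z) 0 = 1 / h z" by (simp add: field_coeff_def)
  show "field_order h (Some z) = 0"
    unfolding field_order_def by (rule zorder_eq_0I[OF an]) (use val z in simp)
  show "field_value h (Some z) = 1 / h z"
    unfolding field_value_def using remove_sings_at_analytic[OF an] val by simp
qed

lemma field_order_eq:
  assumes h: "rational_form h" and z: "h z \<noteq> 0"
  shows "field_order h p = - form_order h p"
proof -
  obtain v where v: "local_coeff h p v \<noteq> 0" by (rule local_coeff_nonzero[OF h z])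
  obtain u e where u: "e > 0" "u holomorphic_on ball 0 e" "\<And>w. w \<in> ball 0 e \<Longrightarrow> u w \<noteq> 0"
    "\<And>w. \<lbrakk>w \<in> ball 0 e; w \<noteq> 0\<rbrakk> \<Longrightarrow> local_coeff h p w = u w * w powi form_order h p"
    by (rule rational_form_local_factorization[OF rational_form_local_coeff[OF h] v, folded form_order_def])
       (rule that)
  have hol: "(\<lambda>w. 1 / u w) holomorphic_on ball 0 e"
    using u(2,3) by (intro holomorphic_intros)
  show ?thesis
    unfolding field_order_def
    by (rule zorder_eqI[OF open_ball _ hol])
       (use u in \<open>auto simp: field_coeff_def power_int_minus field_simps\<close>)
qed

text \<open>
  For curves that avoid \<open>\<infinity>\<close> and the zeros and poles of the field, the chart-dependent definition of a
  trajectory reduces to the differential equation \<open>y' = 1 / h y\<close> in the plane.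
\<close>

lemma trajectory_finite_plane:
  assumes h: "rational_form h" and nz: "\<And>t. h (y t) \<noteq> 0"
    and der: "\<And>t. (y has_vector_derivative 1 / h (y t)) (at t)"
  shows "trajectory h (\<lambda>t. Some (y t))"
  unfolding trajectory_def
proof (intro conjI allI)
  have "continuous_on UNIV y"
    by (intro continuous_at_imp_continuous_on ballI has_vector_derivative_continuous[OF der])
  then have "continuous_map euclideanreal euclidean y" by simp
  from continuous_map_compose[OF this continuous_map_Some]
  show "continuous_map euclideanreal sphere_topology (\<lambda>t. Some (y t))"
    unfolding sphere_topology_def comp_def .
  fix t
  show "0 \<le> field_order h (Some (y t))"
    using field_at_regular_point(1)[OF h nz[of t]] by simp
  show "((\<lambda>s. sphere_coord (Some (y t)) (Some (y s))) has_vector_derivative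
      field_value h (Some (y t))) (at t)"
    using has_vector_derivative_diff[OF der[of t] has_vector_derivative_const[of "y t"]]
    by (simp add: field_at_regular_point(2)[OF h nz])
qed

text \<open>
  The inverse of \<open>sphere_coord p\<close> on its chart domain, sending \<open>0\<close> to \<open>p\<close>.
\<close>

fun sphere_chart :: "riemann_sphere \<Rightarrow> complex \<Rightarrow> riemann_sphere" where
  "sphere_chart (Some a) w = Some (a + w)"
| "sphere_chart None w = (if w = 0 then None else Some (1 / w))"

lemma sphere_chart_0 [simp]: "sphere_chart p 0 = p"
  by (cases p) auto

lemma sphere_chart_eq_iff [simp]: "sphere_chart p v = sphere_chart p w \<longleftrightarrow> v = w"
  by (cases p) auto

text \<open>
  At \<open>p = \<infinity>\<close> the complement of the image is compact: it is closed, and bounded by \<open>1 / s\<close> if \<open>V\<close>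
  contains the disc of radius \<open>s\<close> around \<open>0\<close>.
\<close>

lemma openin_sphere_chart_image:
  assumes V: "open V" and 0: "0 \<in> V"
  shows "openin sphere_topology (sphere_chart p ` V)"
proof (cases p)
  case (Some a)
  have "sphere_chart p ` V = Some ` ((\<lambda>w. a + w) ` V)" using Some by auto
  then show ?thesis
    using open_translation[OF V, of a] by (simp add: sphere_topology_def)
next
  case None
  define C where "C = - ((- {0}) \<inter> inverse -` V)"
  have "open ((- {0}) \<inter> inverse -` V)"
    by (intro continuous_open_preimage continuous_intros) (use V in auto)
  then have "closed C" unfolding C_def by (rule closed_Compl)
  obtain s where s: "s > 0" "ball 0 s \<subseteq> V" using V 0 open_contains_ball by blast
  have "norm z \<le> 1 / s" if "z \<in> C" for z
  proof (cases "z = 0")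
    case False
    then have "inverse z \<notin> ball 0 s" using that s(2) by (auto simp: C_def)
    then have "s \<le> inverse (norm z)" by (simp add: norm_inverse)
    then show ?thesis using False s(1) by (simp add: field_simps)
  qed (use s in simp)
  then have "bounded C" by (auto simp: bounded_iff)
  then have "compact C" using \<open>closed C\<close> by (simp add: compact_eq_bounded_closed)
  have "sphere_chart p ` V = insert None (Some ` (UNIV - C))"
  proof (rule set_eqI)
    fix q
    show "q \<in> sphere_chart p ` V \<longleftrightarrow> q \<in> insert None (Some ` (UNIV - C))"
    proof (cases q)
      case (Some z)
      have "Some z \<in> sphere_chart None ` V \<longleftrightarrow> z \<noteq> 0 \<and> inverse z \<in> V"
        by (auto simp: image_iff inverse_eq_divide split: if_splits intro!: bexI[of _ "1 / z"])
      then show ?thesis using \<open>p = None\<close> Some by (auto simp: C_def)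
    qed (use \<open>p = None\<close> 0 in \<open>auto intro!: image_eqI[of _ _ 0]\<close>)
  qed
  then show ?thesis
    using \<open>compact C\<close> \<open>closed C\<close> unfolding sphere_topology_def openin_Alexandroff_compactification
    by auto
qed

text \<open>
  A solution that stays away from the centre of the chart at \<open>p\<close> runs in the finite plane, even when
  \<open>p = \<infinity>\<close>; the chain rule for \<open>w \<mapsto> 1 / w\<close> translates the equation in that case.
\<close>

lemma trajectory_in_chart:
  assumes h: "rational_form h" and nz: "\<And>t. x t \<noteq> 0" "\<And>t. local_coeff h p (x t) \<noteq> 0"
    and der: "\<And>t. (x has_vector_derivative 1 / local_coeff h p (x t)) (at t)"
  shows "trajectory h (\<lambda>t. sphere_chart p (x t))"
proof (cases p)
  case (Some a)
  have "trajectory h (\<lambda>t. Some (a + x t))"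
  proof (rule trajectory_finite_plane[OF h])
    show "h (a + x t) \<noteq> 0" for t using nz(2)[of t] Some by simp
    show "((\<lambda>t. a + x t) has_vector_derivative 1 / h (a + x t)) (at t)" for t
      using has_vector_derivative_add[OF has_vector_derivative_const[of a] der[of t]] Some by simp
  qed
  then show ?thesis using Some by simp
next
  case None
  have "trajectory h (\<lambda>t. Some (1 / x t))"
  proof (rule trajectory_finite_plane[OF h])
    fix t
    show "h (1 / x t) \<noteq> 0" using nz[of t] None by simp
    have "((\<lambda>w. 1 / w) has_field_derivative - 1 / (x t)\<^sup>2) (at (x t))"
      using nz(1)[of t] by (auto intro!: derivative_eq_intros simp: power2_eq_square)
    from field_vector_diff_chain_at[OF der[of t] this]
    show "((\<lambda>t. 1 / x t) has_vector_derivative 1 / h (1 / x t)) (at t)"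
      using None nz(1)[of t] by (simp add: comp_def field_simps)
  qed
  then show ?thesis using None nz(1) by simp
qed

section \<open>Imaginary residues and centers\<close>

text \<open>
  For the form \<open>(u w / w) dw\<close> with residue \<open>u 0\<close>, the last conclusion says that
  \<open>d\<psi> / \<psi>\<close> is the form divided by its residue, that is, the field reads \<open>\<psi> / u 0\<close> in the coordinate \<open>\<psi>\<close>.
  Integrating gives \<open>ln \<psi> = ln w + K w\<close> up to a constant, where \<open>K\<close> is a primitive of the regular part
  \<open>k\<close> of \<open>u w / (u 0 * w)\<close>; the logarithm of \<open>w\<close> becomes the factor \<open>w\<close> in \<open>\<psi> w = w exp (K w - K 0)\<close>.
\<close>

lemma simple_pole_linearization:
  assumes e: "e > 0" and u: "u holomorphic_on ball 0 e" "u 0 \<noteq> 0"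
  obtains \<psi> where "\<psi> holomorphic_on ball 0 e" "\<psi> 0 = 0" "deriv \<psi> 0 = 1"
    "\<And>w. \<lbrakk>w \<in> ball 0 e; w \<noteq> 0\<rbrakk> \<Longrightarrow> \<psi> w \<noteq> 0"
    "\<And>w. \<lbrakk>w \<in> ball 0 e; w \<noteq> 0\<rbrakk> \<Longrightarrow> deriv \<psi> w = \<psi> w * (u w / w) / u 0"
proof -
  define g where "g w = u w / u 0" for w
  define k where "k w = (if w = 0 then deriv g 0 else g w / w - g 0 / (w - 0))" for w
  have "g holomorphic_on ball 0 e" unfolding g_def using u by (intro holomorphic_intros)
  then have "k holomorphic_on ball 0 e"
    unfolding k_def by (rule pole_theorem_open) auto
  then obtain K where K: "\<And>w. w \<in> ball 0 e \<Longrightarrow> (K has_field_derivative k w) (at w within ball 0 e)"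
    using holomorphic_convex_primitive'[OF convex_ball open_ball] by blast
  then have K: "(K has_field_derivative k w) (at w)" if "w \<in> ball 0 e" for w
    using that at_within_open[OF that] by fastforce
  define \<psi> where "\<psi> w = w * exp (K w - K 0)" for w
  have der: "(\<psi> has_field_derivative exp (K w - K 0) * (1 + w * k w)) (at w)" if "w \<in> ball 0 e" for w
    unfolding \<psi>_def by (rule derivative_eq_intros K[OF that] refl | simp add: algebra_simps)+
  show thesis
  proof (rule that)
    show "\<psi> holomorphic_on ball 0 e"
      using der by (meson holomorphic_on_open open_ball)
    show "\<psi> 0 = 0" by (simp add: \<psi>_def)
    show "deriv \<psi> 0 = 1" using DERIV_imp_deriv[OF der[of 0]] e by simp
    fix w :: complex assume w: "w \<in> ball 0 e" "w \<noteq> 0"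
    show "\<psi> w \<noteq> 0" using w by (simp add: \<psi>_def)
    have "1 + w * k w = g w" using w u(2) by (simp add: k_def g_def field_simps)
    then show "deriv \<psi> w = \<psi> w * (u w / w) / u 0"
      using DERIV_imp_deriv[OF der[OF w(1)]] w u(2) by (simp add: \<psi>_def g_def)
  qed
qed

text \<open>
  Write \<open>1 / r = \<i> \<omega>\<close> with \<open>\<omega>\<close> real. In the linearizing coordinate the flow is multiplication by
  \<open>exp (\<i> \<omega> t)\<close>, which maps every circle around \<open>0\<close> to itself and has period \<open>2 \<pi> / \<bar>\<omega>\<bar>\<close>.
\<close>

lemma imaginary_residue_center:
  assumes h: "rational_form h" and z: "h z \<noteq> 0" and order: "form_order h p = -1"
    and imaginary: "\<And>r. leading_term (local_coeff h p) (-1) r \<Longrightarrow> cnj r = - r"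
  shows "is_center h p"
proof -
  obtain v where v: "local_coeff h p v \<noteq> 0" by (rule local_coeff_nonzero[OF h z])
  obtain u e where u: "e > 0" "u holomorphic_on ball 0 e" "\<And>w. w \<in> ball 0 e \<Longrightarrow> u w \<noteq> 0"
    "\<And>w. \<lbrakk>w \<in> ball 0 e; w \<noteq> 0\<rbrakk> \<Longrightarrow> local_coeff h p w = u w * w powi form_order h p"
    by (rule rational_form_local_factorization[OF rational_form_local_coeff[OF h] v, folded form_order_def])
       (rule that)
  have coeff: "local_coeff h p w = u w / w" if "w \<in> ball 0 e" "w \<noteq> 0" for w
    using u(4)[OF that] by (simp add: order power_int_minus divide_inverse)
  have u0: "u 0 \<noteq> 0" using u(1,3) by simp
  have "leading_term (local_coeff h p) (-1) (u 0)"
    using leading_term_factorization[OF u(1,2) u0] u(4) order by auto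
  then have "cnj (u 0) = - u 0" by (rule imaginary)
  then have "cnj (1 / u 0) = - (1 / u 0)" by simp
  then have "Re (1 / u 0) = 0" by (simp only: complex_eq_iff complex_cnj uminus_complex.simps cnj.simps) simp
  define \<omega> where "\<omega> = Im (1 / u 0)"
  have \<omega>: "\<i> * of_real \<omega> = 1 / u 0"
    using \<open>Re (1 / u 0) = 0\<close> by (simp only: complex_eq_iff \<omega>_def) simp
  then have \<omega>0: "\<omega> \<noteq> 0" using u0 by auto
  obtain \<psi> where \<psi>: "\<psi> holomorphic_on ball 0 e" "\<psi> 0 = 0" "deriv \<psi> 0 = 1"
    "\<And>w. \<lbrakk>w \<in> ball 0 e; w \<noteq> 0\<rbrakk> \<Longrightarrow> \<psi> w \<noteq> 0"
    "\<And>w. \<lbrakk>w \<in> ball 0 e; w \<noteq> 0\<rbrakk> \<Longrightarrow> deriv \<psi> w = \<psi> w * (u w / w) / u 0"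
    by (rule simple_pole_linearization[OF u(1,2) u0]) (rule that)
  have "0 \<in> ball (0::complex) e" "deriv \<psi> 0 \<noteq> 0" using u(1) \<psi>(3) by auto
  then obtain d where d: "d > 0" "ball (0::complex) d \<subseteq> ball 0 e" "inj_on \<psi> (ball 0 d)"
    by (rule has_complex_derivative_locally_injective[OF \<psi>(1) _ open_ball]) (rule that)
  have \<psi>d: "\<psi> holomorphic_on ball 0 d" using \<psi>(1) d(2) holomorphic_on_subset by blast
  obtain \<phi> where \<phi>: "\<phi> holomorphic_on (\<psi> ` ball 0 d)"
    "\<And>w. w \<in> ball 0 d \<Longrightarrow> deriv \<psi> w * deriv \<phi> (\<psi> w) = 1" "\<And>w. w \<in> ball 0 d \<Longrightarrow> \<phi> (\<psi> w) = w"
    by (rule holomorphic_has_inverse[OF \<psi>d open_ball d(3)]) (rule that)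
  have open_image: "open (\<psi> ` ball 0 d)" by (rule open_mapping_thm3[OF \<psi>d open_ball d(3)])
  moreover have "0 \<in> \<psi> ` ball 0 d" using \<psi>(2) d(1) by force
  ultimately obtain s where s: "s > 0" "ball 0 s \<subseteq> \<psi> ` ball 0 d"
    using open_contains_ball by blast
  \<comment> \<open>In the coordinate \<open>\<psi>\<close> the set \<open>V\<close> is a round disc, hence invariant under the rotations.\<close>
  define V where "V = ball 0 d \<inter> \<psi> -` ball 0 s"
  have "open V" unfolding V_def
    using \<psi>d holomorphic_on_imp_continuous_on by (intro continuous_open_preimage) auto
  have "0 \<in> V" using d(1) s(1) \<psi>(2) by (simp add: V_def)
  have orbit: "\<exists>\<gamma>. closed_trajectory h \<gamma> \<and> \<gamma> 0 = q \<and> range \<gamma> \<subseteq> sphere_chart p ` V - {p}"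
    if q: "q \<in> sphere_chart p ` V - {p}" for q
  proof -
    obtain w0 where w0: "w0 \<in> V" "w0 \<noteq> 0" "q = sphere_chart p w0" using q sphere_chart_0 by blast
    define \<zeta> where "\<zeta> t = exp (\<i> * of_real (\<omega> * t)) * \<psi> w0" for t :: real
    define x where "x t = \<phi> (\<zeta> t)" for t
    have \<psi>w0: "\<psi> w0 \<noteq> 0" "\<psi> w0 \<in> ball 0 s" using \<psi>(4) w0 d(2) by (auto simp: V_def)
    have norm_\<zeta>: "norm (\<zeta> t) = norm (\<psi> w0)" for t by (simp add: \<zeta>_def norm_mult)
    have \<zeta>_image: "\<zeta> t \<in> \<psi> ` ball 0 d" for t
    proof -
      have "\<zeta> t \<in> ball 0 s" using \<psi>w0(2) norm_\<zeta>[of t] by simp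
      then show ?thesis using s(2) by blast
    qed
    have x: "x t \<in> ball 0 d" "\<psi> (x t) = \<zeta> t" for t
      using \<zeta>_image[of t] \<phi>(3) by (auto simp: x_def)
    have x0: "x t \<noteq> 0" for t using x(2)[of t] \<psi>(2) norm_\<zeta>[of t] \<psi>w0(1) by auto
    have xe: "x t \<in> ball 0 e" for t using x(1) d(2) by blast
    have xV: "x t \<in> V" for t using x[of t] norm_\<zeta>[of t] \<psi>w0(2) by (simp add: V_def)
    have x_der: "(x has_vector_derivative 1 / local_coeff h p (x t)) (at t)" for t
    proof -
      have exp_der: "((\<lambda>t. exp (\<i> * of_real (\<omega> * t))) has_vector_derivative
          \<i> * of_real \<omega> * exp (\<i> * of_real (\<omega> * t))) (at t)"
        by (auto intro!: derivative_eq_intros has_vector_derivative_real_field)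
      have \<zeta>_der: "(\<zeta> has_vector_derivative \<i> * of_real \<omega> * \<zeta> t) (at t)"
        using has_vector_derivative_mult_left[OF exp_der, of "\<psi> w0"]
        unfolding \<zeta>_def by (simp only: mult.assoc)
      have "(\<phi> has_field_derivative deriv \<phi> (\<zeta> t)) (at (\<zeta> t))"
        by (rule holomorphic_derivI[OF \<phi>(1) open_image \<zeta>_image])
      from field_vector_diff_chain_at[OF \<zeta>_der this]
      have "(x has_vector_derivative \<i> * of_real \<omega> * \<zeta> t * deriv \<phi> (\<zeta> t)) (at t)"
        by (simp add: comp_def x_def[abs_def])
      moreover have "\<i> * of_real \<omega> * \<zeta> t * deriv \<phi> (\<zeta> t) = 1 / local_coeff h p (x t)"
      proof -
        have "\<zeta> t * local_coeff h p (x t) / u 0 * deriv \<phi> (\<zeta> t) = 1"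
          using \<phi>(2)[OF x(1)[of t]] \<psi>(5)[OF xe x0, of t] x(2)[of t] coeff[OF xe x0, of t] by simp
        moreover have "local_coeff h p (x t) \<noteq> 0" using coeff[OF xe x0] u(3)[OF xe] x0 by simp
        ultimately show ?thesis unfolding \<omega> by (simp add: field_simps)
      qed
      ultimately show ?thesis by simp
    qed
    define \<gamma> where "\<gamma> t = sphere_chart p (x t)" for t
    have traj: "trajectory h \<gamma>"
      unfolding \<gamma>_def using coeff[OF xe x0] u(3)[OF xe] x0
      by (intro trajectory_in_chart[OF h x0 _ x_der]) simp
    \<comment> \<open>Half a turn sends \<open>\<psi> w0\<close> to its negative, so the orbit is not constant.\<close>
    have "\<gamma> (pi / \<omega>) \<noteq> \<gamma> 0"
    proof
      assume "\<gamma> (pi / \<omega>) = \<gamma> 0"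
      then have "\<zeta> (pi / \<omega>) = \<zeta> 0" using x(2) by (metis \<gamma>_def sphere_chart_eq_iff)
      then show False using \<psi>w0(1) \<omega>0 by (simp add: \<zeta>_def exp_pi_i)
    qed
    moreover have "\<gamma> (t + 2 * pi / \<bar>\<omega>\<bar>) = \<gamma> t" for t
    proof -
      have "\<omega> * (t + 2 * pi / \<bar>\<omega>\<bar>) = \<omega> * t + sgn \<omega> * (2 * pi)"
        using \<omega>0 by (simp add: field_simps sgn_if abs_if)
      then have "exp (\<i> * of_real (\<omega> * (t + 2 * pi / \<bar>\<omega>\<bar>))) = exp (\<i> * of_real (\<omega> * t))"
        using \<omega>0 by (auto simp: sgn_if exp_add exp_diff distrib_left right_diff_distrib exp_eq_1
            intro!: exI[of _ "-1::int"])
      then show ?thesis by (simp add: \<gamma>_def x_def \<zeta>_def)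
    qed
    moreover have "2 * pi / \<bar>\<omega>\<bar> > 0" using \<omega>0 by simp
    ultimately have "closed_trajectory h \<gamma>"
      using traj unfolding closed_trajectory_def by blast
    moreover have "\<gamma> 0 = q"
      using \<phi>(3)[of w0] w0 by (simp add: \<gamma>_def x_def \<zeta>_def V_def)
    moreover have "\<gamma> t \<noteq> p" for t using x0[of t] sphere_chart_eq_iff[of p "x t" 0] by (simp add: \<gamma>_def)
    then have "range \<gamma> \<subseteq> sphere_chart p ` V - {p}" using xV by (auto simp: \<gamma>_def)
    ultimately show ?thesis by blast
  qed
  have "p \<in> field_zeros h" by (simp add: field_zeros_def field_order_eq[OF h z] order)
  moreover have "p \<in> sphere_chart p ` V" using \<open>0 \<in> V\<close> sphere_chart_0[of p] by (metis imageI)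
  ultimately show ?thesis
    unfolding is_center_def
    using openin_sphere_chart_image[OF \<open>open V\<close> \<open>0 \<in> V\<close>, of p] orbit by blast
qed

section \<open>Rotating the residues\<close>

lemma infinite_PSL2C: "infinite PSL2C"
proof -
  have "inj (\<lambda>b. moebius_map 1 b 0 1)"
  proof (rule injI)
    fix b b' assume "moebius_map 1 b 0 1 = moebius_map 1 b' 0 1"
    then have "moebius_map 1 b 0 1 (Some 0) = moebius_map 1 b' 0 1 (Some 0)" by simp
    then show "b = b'" by simp
  qed
  then have "infinite (range (\<lambda>b. moebius_map 1 b 0 1))"
    using finite_imageD infinite_UNIV_char_0[where 'a = complex] by blast
  moreover have "range (\<lambda>b. moebius_map 1 b 0 1) \<subseteq> PSL2C"
    by (auto intro: moebius_map_in_PSL2C)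
  ultimately show ?thesis using finite_subset by blast
qed

text \<open>
  The zero function is a rational form in the sense of the definition, and orders are
  meaningless for it. It is excluded because all of the infinitely many Moebius transformations
  preserve it.
\<close>

lemma form_nonzero_if_finite_isotropy:
  assumes "finite (isotropy_group h)"
  obtains z where "h z \<noteq> 0"
proof -
  have "\<exists>z. h z \<noteq> 0"
  proof (rule ccontr)
    assume "\<not> (\<exists>z. h z \<noteq> 0)"
    then have "isotropy_group h = PSL2C"
      by (auto simp: isotropy_group_def form_eq_def pushforward_def pullback_def)
    then show False using assms infinite_PSL2C by simp
  qed
  then show thesis using that by blast
qed

text \<open>
  From \<open>cnj r = k * r\<close> the constant \<open>k\<close> has modulus one, and half the argument of \<open>-k\<close> is the angle for
  which \<open>\<epsilon>\<^sup>2 = -k\<close>. It depends only on \<open>k\<close>, so the same rotation serves all poles.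
\<close>

lemma rotate_to_imaginary:
  assumes "cnj r = k * r" and "r \<noteq> 0"
  defines "\<epsilon> \<equiv> exp (\<i> * of_real (Arg (-k) / 2))"
  shows "cnj (\<epsilon> * r) = - (\<epsilon> * r)"
proof -
  have "norm k = 1"
    using arg_cong[OF assms(1), of norm] assms(2) by (simp add: norm_mult)
  moreover from this have "-k \<noteq> 0" by auto
  ultimately have "-k = exp (\<i> * of_real (Arg (-k)))"
    using Arg_eq[of "-k"] by simp
  also have "\<dots> = \<epsilon> * \<epsilon>"
    unfolding \<epsilon>_def by (simp flip: exp_add)
  finally have "k = - (\<epsilon> * \<epsilon>)" by (metis minus_minus)
  moreover have "cnj \<epsilon> * \<epsilon> = 1"
    by (simp add: \<epsilon>_def exp_cnj flip: exp_add)
  ultimately show ?thesis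
    using assms(1) by (simp add: algebra_simps)
qed

theorem theorem4p3:
  fixes \<eta> :: "complex \<Rightarrow> complex" and G :: "(riemann_sphere \<Rightarrow> riemann_sphere) set"
    and E :: "riemann_sphere set"
  assumes "rational_form \<eta>" and "simple_poles \<eta>" and "simple_zeros \<eta>"
    and "G = isotropy_group \<eta>" and "finite G" and "G \<noteq> {id}"
    and "is_circle E"
    and "\<And>p. p \<in> form_poles \<eta> \<Longrightarrow>
           circle_reflection E p \<in> orbit_of G p \<and> orbit_of G p \<subseteq> form_poles \<eta>"
    and "\<And>q. q \<in> form_zeros \<eta> \<Longrightarrow>
           circle_reflection E q \<in> orbit_of G q \<and> orbit_of G q \<subseteq> form_zeros \<eta>"
  shows "\<exists>\<theta>::real. isochronous (\<lambda>z. exp (\<i> * of_real \<theta>) * \<eta> z)"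
proof -
  let ?\<rho> = "circle_reflection E"
  obtain z where z: "\<eta> z \<noteq> 0"
    using form_nonzero_if_finite_isotropy assms(4,5) by blast
  have poles: "?\<rho> p \<in> form_poles \<eta>" if "p \<in> form_poles \<eta>" for p
    using assms(8)[OF that] by blast
  have zeros: "?\<rho> p \<in> form_zeros \<eta>" if "p \<in> form_zeros \<eta>" for p
    using assms(9)[OF that] by blast
  \<comment> \<open>As poles and zeros are simple, the order is determined by which of the two sets contains the point.\<close>
  have orders: "form_order \<eta> (?\<rho> p) = form_order \<eta> p" for p
  proof -
    have sym: "?\<rho> p \<in> form_poles \<eta> \<longleftrightarrow> p \<in> form_poles \<eta>"
        "?\<rho> p \<in> form_zeros \<eta> \<longleftrightarrow> p \<in> form_zeros \<eta>"
      using poles zeros circle_reflection_involution[OF assms(7)] by metis+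
    have order: "form_order \<eta> q = (if q \<in> form_poles \<eta> then -1 else if q \<in> form_zeros \<eta> then 1 else 0)" for q
    proof -
      have "q \<in> form_poles \<eta> \<Longrightarrow> form_order \<eta> q = -1" "q \<in> form_zeros \<eta> \<Longrightarrow> form_order \<eta> q = 1"
        using assms(2,3) unfolding simple_poles_def simple_zeros_def by blast+
      moreover have "form_order \<eta> q = 0" if "q \<notin> form_poles \<eta>" "q \<notin> form_zeros \<eta>"
        using that unfolding form_poles_def form_zeros_def by simp
      ultimately show ?thesis by presburger
    qed
    show ?thesis unfolding order[of p] order[of "?\<rho> p"] sym ..
  qed
  have residues: "leading_term (local_coeff \<eta> (?\<rho> p)) (-1) r"
    if r: "leading_term (local_coeff \<eta> p) (-1) r" for p r
  proof -
    have "p \<in> form_poles \<eta>" using form_order_eqI[OF assms(1) r] by (simp add: form_poles_def)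
    then obtain T where "T \<in> isotropy_group \<eta>" "?\<rho> p = T p"
      using assms(4,8) by (auto simp: orbit_of_def)
    then show ?thesis using isotropy_preserves_residue[OF assms(1) _ r] by simp
  qed
  obtain k where k: "\<And>p r. leading_term (local_coeff \<eta> p) (-1) r \<Longrightarrow> cnj r = k * r"
    by (rule reflection_symmetric_residues[OF assms(1) z assms(7) orders]) (erule residues, rule that)
  define \<epsilon> where "\<epsilon> = exp (\<i> * of_real (Arg (-k) / 2))"
  have \<epsilon>: "\<epsilon> \<noteq> 0" by (simp add: \<epsilon>_def)
  define \<eta>' where "\<eta>' z = \<epsilon> * \<eta> z" for z
  have \<eta>': "rational_form \<eta>'" "\<eta>' z \<noteq> 0"
    using rational_form_cmult[OF assms(1)] z \<epsilon> by (auto simp: \<eta>'_def[abs_def])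
  have "is_center \<eta>' p" if p: "p \<in> field_zeros \<eta>'" for p
  proof -
    obtain r where r: "leading_term (local_coeff \<eta> p) (form_order \<eta> p) r"
      using form_leading_term[OF assms(1) z] by blast
    have r': "leading_term (local_coeff \<eta>' p) (form_order \<eta> p) (\<epsilon> * r)"
      using leading_term_local_coeff_cmult[OF r \<epsilon>] by (simp add: \<eta>'_def[abs_def])
    have same: "form_order \<eta>' p = form_order \<eta> p" by (rule form_order_eqI[OF \<eta>'(1) r'])
    have "p \<in> form_poles \<eta>"
      using p by (simp add: field_zeros_def field_order_eq[OF \<eta>'] same form_poles_def)
    then have order: "form_order \<eta> p = -1" using assms(2) by (simp add: simple_poles_def)
    have "r \<noteq> 0" using r by (simp add: leading_term_def)
    then have "cnj (\<epsilon> * r) = - (\<epsilon> * r)"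
      unfolding \<epsilon>_def using k r order by (intro rotate_to_imaginary) auto
    then have "cnj s = - s" if "leading_term (local_coeff \<eta>' p) (-1) s" for s
      using leading_term_unique[OF that] r' order by metis
    then show ?thesis using imaginary_residue_center[OF \<eta>'] same order by simp
  qed
  then have "isochronous \<eta>'" by (simp add: isochronous_def)
  then show ?thesis unfolding \<eta>'_def[abs_def] \<epsilon>_def by blast
qed

end
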